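(* Let $M_0,M_1\ge 0$ be integers and $M=M_0+2M_1$. Let $\alpha_1,\dots,\alpha_M$ be pairwise distinct complex numbers with $\operatorname{Re}\alpha_m>0$, and let $P_m(t)$ be a polynomial of degree (exactly) $K_m$, $m=1,\dots,M$, such that: $\operatorname{Im}\alpha_m=0$ and $P_m(t)=\overline{P_m(t)}$ (for real $t$) for $m=1,\dots,M_0$; and $\operatorname{Im}\alpha_m>0$, $\alpha_{M_1+m}=\overline{\alpha_m}$, $P_{M_1+m}(t)=\overline{P_m(t)}$ (for real $t$) for $m=M_0+1,\dots,M_0+M_1$. Let $$h(t)=\sum_{m=1}^M P_m(t)e^{-\alpha_m t},\qquad t>0,$$ and let $H$ be the self-adjoint finite rank Hankel operator in $L^2(\mathbb{R}_+)$ with kernel $h$, i.e. $(Hf)(t)=\int_0^\infty h(t+s)f(s)\,ds$. Then the total numbers $N_\pm(H)$ of (strictly) positive and negative eigenvalues of $H$ are given by $$N_\pm(H)=\sum_{m=1}^{M_0}\mathcal{N}_\pm^{(m)}+\sum_{m=M_0+1}^{M_0+M_1}K_m+M_1,$$ where for $m=1,\dots,M_0$, with $\mathsf{p}_m=P_m^{(K_m)}$ (the $K_m$-th derivative of $P_m$, a nonzero real constant), the numbers $\mathcal{N}_\pm^{(m)}$ are defined by $$\mathcal{N}_+^{(m)}=\mathcal{N}_-^{(m)}=(K_m+1)/2\quad\text{if }K_m\text{ is odd},$$ $$\mathcal{N}_+^{(m)}-1=\mathcal{N}_-^{(m)}=K_m/2\quad\text{if }K_m\text{ is even and }\mathsf{p}_m>0,$$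 $$\mathcal{N}_+^{(m)}=\mathcal{N}_-^{(m)}-1=K_m/2\quad\text{if }K_m\text{ is even and }\mathsf{p}_m<0.$$
   Context: For a self-adjoint operator $A$, $N_+(A)$ (respectively $N_-(A)$) denotes the total multiplicity of its strictly positive (respectively strictly negative) spectrum; eigenvalues are counted with multiplicity. $\mathbb{R}_+=(0,\infty)$. Empty sums are zero; the cases $M_0=0$ or $M_1=0$ are allowed. *)

theory Defs
  imports
    "HOL-Analysis.Analysis"
    "HOL-Library.Extended_Nat"
    "HOL-Computational_Algebra.Polynomial"
begin

section \<open>The complex Hilbert space of square-integrable functions on the half-line\<close>

abbreviation half_line :: "real measure" where
  "half_line \<equiv> lebesgue_on {0<..}"

definition square_integrable :: "(real \<Rightarrow> complex) \<Rightarrow> bool" where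
  "square_integrable f \<longleftrightarrow>
     f \<in> borel_measurable half_line \<and> integrable half_line (\<lambda>t. (cmod (f t))\<^sup>2)"

lemma square_integrable_zero: "square_integrable (\<lambda>t. 0)"
  by (simp add: square_integrable_def)

lemma square_integrable_mult_left:
  assumes "square_integrable f"
  shows "square_integrable (\<lambda>t. c * f t)"
  using assms by (auto simp: square_integrable_def norm_mult power_mult_distrib)

lemma square_integrable_add:
  assumes f: "square_integrable f" and g: "square_integrable g"
  shows "square_integrable (\<lambda>t. f t + g t)"
proof -
  have [measurable]: "f \<in> borel_measurable half_line" "g \<in> borel_measurable half_line"
    using f g by (auto simp: square_integrable_def)
  have "integrable half_line (\<lambda>t. (cmod (f t + g t))\<^sup>2)"
  proof (rule Bochner_Integration.integrable_bound)
    show "integrable half_line (\<lambda>t. 2 * (cmod (f t))\<^sup>2 + 2 * (cmod (g t))\<^sup>2)"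
      using f g by (auto simp: square_integrable_def)
    have "(cmod (f t + g t))\<^sup>2 \<le> 2 * (cmod (f t))\<^sup>2 + 2 * (cmod (g t))\<^sup>2" for t
    proof -
      have "(cmod (f t + g t))\<^sup>2 \<le> (cmod (f t) + cmod (g t))\<^sup>2"
        by (intro power_mono norm_triangle_ineq) auto
      also have "\<dots> \<le> 2 * (cmod (f t))\<^sup>2 + 2 * (cmod (g t))\<^sup>2"
        using sum_squares_bound[of "cmod (f t)" "cmod (g t)"] by (simp add: power2_sum)
      finally show ?thesis .
    qed
    then show "AE t in half_line. norm ((cmod (f t + g t))\<^sup>2)
        \<le> norm (2 * (cmod (f t))\<^sup>2 + 2 * (cmod (g t))\<^sup>2)"
      by (intro AE_I2) simp
  qed measurable
  then show ?thesis by (simp add: square_integrable_def)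
qed

lemma square_integrable_uminus:
  "square_integrable f \<Longrightarrow> square_integrable (\<lambda>t. - f t)"
  using square_integrable_mult_left[of f "-1"] by simp

lemma square_integrable_diff:
  "square_integrable f \<Longrightarrow> square_integrable g \<Longrightarrow> square_integrable (\<lambda>t. f t - g t)"
  using square_integrable_add[OF _ square_integrable_uminus, of f g] by simp

lemma integrable_mult_cnj:
  assumes f: "square_integrable f" and g: "square_integrable g"
  shows "integrable half_line (\<lambda>t. f t * cnj (g t))"
proof (rule Bochner_Integration.integrable_bound)
  have [measurable]: "f \<in> borel_measurable half_line" "g \<in> borel_measurable half_line"
    using f g by (auto simp: square_integrable_def)
  show "integrable half_line (\<lambda>t. (cmod (f t))\<^sup>2 + (cmod (g t))\<^sup>2)"
    using f g by (auto simp: square_integrable_def)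
  show "(\<lambda>t. f t * cnj (g t)) \<in> borel_measurable half_line"
  proof -
    have "(\<lambda>t. cnj (g t)) \<in> borel_measurable half_line"
      by (rule borel_measurable_continuous_on[OF continuous_on_cnj[OF continuous_on_id]]) measurable
    then show ?thesis by measurable
  qed
  have "cmod (f t) * cmod (g t) \<le> (cmod (f t))\<^sup>2 + (cmod (g t))\<^sup>2" for t
  proof -
    have "0 \<le> cmod (f t) * cmod (g t)" by simp
    then show ?thesis using sum_squares_bound[of "cmod (f t)" "cmod (g t)"] by linarith
  qed
  then show "AE t in half_line. norm (f t * cnj (g t)) \<le> norm ((cmod (f t))\<^sup>2 + (cmod (g t))\<^sup>2)"
    by (intro AE_I2) (simp add: norm_mult)
qed

quotient_type L2 = "real \<Rightarrow> complex" / partial: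
  "\<lambda>f g. square_integrable f \<and> square_integrable g \<and> (AE t in half_line. f t = g t)"
proof (rule part_equivpI)
  show "\<exists>f. square_integrable f \<and> square_integrable f \<and> (AE t in half_line. f t = f t)"
    using square_integrable_zero by auto
  show "symp (\<lambda>f g. square_integrable f \<and> square_integrable g \<and> (AE t in half_line. f t = g t))"
    by (auto intro!: sympI elim!: AE_mp)
  show "transp (\<lambda>f g. square_integrable f \<and> square_integrable g \<and> (AE t in half_line. f t = g t))"
  proof (rule transpI, intro conjI)
    fix f g h
    assume 1: "square_integrable f \<and> square_integrable g \<and> (AE t in half_line. f t = g t)"
      and 2: "square_integrable g \<and> square_integrable h \<and> (AE t in half_line. g t = h t)"
    show "square_integrable f" "square_integrable h" using 1 2 by auto
    from 1 have "AE t in half_line. f t = g t" by blast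
    moreover from 2 have "AE t in half_line. g t = h t" by blast
    ultimately show "AE t in half_line. f t = h t" by eventually_elim simp
  qed
qed

instantiation L2 :: real_inner
begin

lift_definition zero_L2 :: L2 is "\<lambda>t. 0"
  by (simp add: square_integrable_zero)

lift_definition plus_L2 :: "L2 \<Rightarrow> L2 \<Rightarrow> L2" is "\<lambda>f g t. f t + g t"
proof (elim conjE, intro conjI)
  fix f f' g g' :: "real \<Rightarrow> complex"
  assume "AE t in half_line. f t = f' t" "AE t in half_line. g t = g' t"
  then show "AE t in half_line. f t + g t = f' t + g' t" by eventually_elim simp
qed (auto intro: square_integrable_add)

lift_definition minus_L2 :: "L2 \<Rightarrow> L2 \<Rightarrow> L2" is "\<lambda>f g t. f t - g t"
proof (elim conjE, intro conjI)
  fix f f' g g' :: "real \<Rightarrow> complex"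
  assume "AE t in half_line. f t = f' t" "AE t in half_line. g t = g' t"
  then show "AE t in half_line. f t - g t = f' t - g' t" by eventually_elim simp
qed (auto intro: square_integrable_diff)

lift_definition uminus_L2 :: "L2 \<Rightarrow> L2" is "\<lambda>f t. - f t"
  by (auto intro: square_integrable_uminus)

lift_definition scaleR_L2 :: "real \<Rightarrow> L2 \<Rightarrow> L2" is "\<lambda>c f t. complex_of_real c * f t"
  by (auto intro: square_integrable_mult_left)

text \<open>The real part of the sesquilinear \<open>L2\<close> inner product; it induces the usual norm.\<close>

lift_definition inner_L2 :: "L2 \<Rightarrow> L2 \<Rightarrow> real" is
  "\<lambda>f g. Re (\<integral>t. f t * cnj (g t) \<partial>half_line)"
proof (elim conjE)
  fix f f' g g' :: "real \<Rightarrow> complex"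
  assume sq: "square_integrable f" "square_integrable f'" "square_integrable g" "square_integrable g'"
    and ae: "AE t in half_line. f t = f' t" "AE t in half_line. g t = g' t"
  from ae have "AE t in half_line. f t * cnj (g t) = f' t * cnj (g' t)"
    by eventually_elim simp
  moreover have "(\<lambda>t. f t * cnj (g t)) \<in> borel_measurable half_line"
    and "(\<lambda>t. f' t * cnj (g' t)) \<in> borel_measurable half_line"
    using integrable_mult_cnj sq by (blast intro: borel_measurable_integrable)+
  ultimately show "Re (\<integral>t. f t * cnj (g t) \<partial>half_line) = Re (\<integral>t. f' t * cnj (g' t) \<partial>half_line)"
    using integral_cong_AE by metis
qed

definition "norm_L2 (f :: L2) = sqrt (inner f f)"
definition "sgn_L2 (f :: L2) = inverse (norm f) *\<^sub>R f"
definition "dist_L2 (f :: L2) g = norm (f - g)"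
definition [code del]:
  "(uniformity :: (L2 \<times> L2) filter) = (INF e\<in>{0<..}. principal {(f, g). dist f g < e})"
definition [code del]:
  "open (U :: L2 set) \<longleftrightarrow> (\<forall>f\<in>U. \<forall>\<^sub>F (f', g) in uniformity. f' = f \<longrightarrow> g \<in> U)"

instance
proof
  fix f g k :: L2 and a b :: real
  show "f + g + k = f + (g + k)"
    by transfer (auto intro!: square_integrable_add simp: add.assoc)
  show "f + g = g + f"
    by transfer (auto intro!: square_integrable_add simp: add.commute)
  show "0 + f = f"
    by transfer (auto simp: square_integrable_def)
  show "- f + f = 0"
    by transfer (auto simp: square_integrable_zero)
  show "f - g = f + - g"
    by transfer (auto intro!: square_integrable_diff)
  show "a *\<^sub>R (f + g) = a *\<^sub>R f + a *\<^sub>R g"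
    by transfer (auto intro!: square_integrable_add square_integrable_mult_left simp: distrib_left)
  show "(a + b) *\<^sub>R f = a *\<^sub>R f + b *\<^sub>R f"
    by transfer (auto intro!: square_integrable_add square_integrable_mult_left
        simp: distrib_right)
  show "a *\<^sub>R b *\<^sub>R f = (a * b) *\<^sub>R f"
    by transfer (auto intro!: square_integrable_mult_left simp: mult.assoc)
  show "1 *\<^sub>R f = f"
    by transfer (auto simp: square_integrable_def)
  show "sgn f = inverse (norm f) *\<^sub>R f" by (simp add: sgn_L2_def)
  show "dist f g = norm (f - g)" by (simp add: dist_L2_def)
  show "inner f g = inner g f"
  proof transfer
    fix f g :: "real \<Rightarrow> complex"
    have "Re (\<integral>t. f t * cnj (g t) \<partial>half_line) = Re (cnj (\<integral>t. f t * cnj (g t) \<partial>half_line))" by simp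
    also have "\<dots> = Re (\<integral>t. cnj (f t * cnj (g t)) \<partial>half_line)"
      by (simp only: Bochner_Integration.integral_cnj)
    finally show "Re (\<integral>t. f t * cnj (g t) \<partial>half_line) = Re (\<integral>t. g t * cnj (f t) \<partial>half_line)"
      by (simp add: mult.commute)
  qed
  show "inner (f + g) k = inner f k + inner g k"
    by transfer (simp add: distrib_right integrable_mult_cnj)
  show "inner (a *\<^sub>R f) g = a * inner f g"
    by transfer (simp add: mult.assoc)
  have self: "f t * cnj (f t) = complex_of_real ((cmod (f t))\<^sup>2)" for f :: "real \<Rightarrow> complex" and t
    by (simp only: complex_norm_square)
  show "0 \<le> inner f f"
    by transfer (simp only: self integral_complex_of_real, simp)
  show "inner f f = 0 \<longleftrightarrow> f = 0"
  proof transfer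
    fix f :: "real \<Rightarrow> complex"
    assume f: "square_integrable f \<and> square_integrable f \<and> (AE t in half_line. f t = f t)"
    then have "(\<integral>t. (cmod (f t))\<^sup>2 \<partial>half_line) = 0 \<longleftrightarrow> (AE t in half_line. (cmod (f t))\<^sup>2 = 0)"
      by (intro integral_nonneg_eq_0_iff_AE) (auto simp: square_integrable_def)
    then show "Re (\<integral>t. f t * cnj (f t) \<partial>half_line) = 0 \<longleftrightarrow>
        square_integrable f \<and> square_integrable (\<lambda>t. 0) \<and> (AE t in half_line. f t = 0)"
      using f by (simp only: self integral_complex_of_real) (simp add: square_integrable_zero)
  qed
  show "norm f = sqrt (inner f f)" by (simp add: norm_L2_def)
qed (fact uniformity_L2_def open_L2_def)+

end

lift_definition scaleC :: "complex \<Rightarrow> L2 \<Rightarrow> L2" (infixr \<open>*\<^sub>C\<close> 75) is "\<lambda>c f t. c * f t"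
  by (auto intro: square_integrable_mult_left)

global_interpretation L2: vector_space scaleC
proof
  fix f g :: L2 and a b :: complex
  show "a *\<^sub>C (f + g) = a *\<^sub>C f + a *\<^sub>C g"
    by transfer (auto intro!: square_integrable_add square_integrable_mult_left simp: distrib_left)
  show "(a + b) *\<^sub>C f = a *\<^sub>C f + b *\<^sub>C f"
    by transfer (auto intro!: square_integrable_add square_integrable_mult_left
        simp: distrib_right)
  show "a *\<^sub>C b *\<^sub>C f = (a * b) *\<^sub>C f"
    by transfer (auto intro!: square_integrable_mult_left simp: mult.assoc)
  show "1 *\<^sub>C f = f"
    by transfer (auto simp: square_integrable_def)
qed


section \<open>Total multiplicity of the positive and of the negative spectrum\<close>

definition spectrum :: "(L2 \<Rightarrow> L2) \<Rightarrow> complex set" where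
  "spectrum A = {z. \<nexists>R. bounded_linear R \<and>
      (\<forall>f. R (A f - z *\<^sub>C f) = f) \<and> (\<forall>f. A (R f) - z *\<^sub>C R f = f)}"

text \<open>\<^const>\<open>L2.dim\<close> is \<open>0\<close> on infinite-dimensional spaces, hence the case distinction.\<close>

definition multiplicity_of :: "(L2 \<Rightarrow> L2) \<Rightarrow> complex \<Rightarrow> enat" where
  "multiplicity_of A z =
     (let E = {f. A f = z *\<^sub>C f} in
      if \<exists>B. finite B \<and> E \<subseteq> L2.span B then enat (L2.dim E) else \<infinity>)"

text \<open>
  For self-adjoint \<open>A\<close> and \<open>S\<close> an open half-line, the rank of the spectral projection of \<open>A\<close>
  onto \<open>S\<close>: if \<open>A\<close> has only finitely many spectral points in \<open>S\<close>, they are isolated,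
  hence eigenvalues, and the rank is the sum of their multiplicities; otherwise it is infinite.
\<close>

definition spectral_count :: "(L2 \<Rightarrow> L2) \<Rightarrow> real set \<Rightarrow> enat" where
  "spectral_count A S =
     (let \<Lambda> = {x \<in> S. complex_of_real x \<in> spectrum A} in
      if finite \<Lambda> then (\<Sum>x\<in>\<Lambda>. multiplicity_of A (complex_of_real x)) else \<infinity>)"

definition N_plus :: "(L2 \<Rightarrow> L2) \<Rightarrow> enat" where
  "N_plus A = spectral_count A {0<..}"

definition N_minus :: "(L2 \<Rightarrow> L2) \<Rightarrow> enat" where
  "N_minus A = spectral_count A {..<0}"


section \<open>Hankel operators\<close>

text \<open>
  The value does not depend on the representative \<^term>\<open>rep_L2 f\<close>. It is the intended one only
  for kernels for which the integral is again a square-integrable function of \<open>t\<close>, such as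
  sums of polynomials times decaying exponentials.
\<close>

definition hankel_op :: "(real \<Rightarrow> complex) \<Rightarrow> L2 \<Rightarrow> L2" where
  "hankel_op h f = abs_L2 (\<lambda>t. \<integral>s. h (t + s) * rep_L2 f s \<partial>half_line)"

definition exp_poly_kernel ::
    "nat \<Rightarrow> (nat \<Rightarrow> complex) \<Rightarrow> (nat \<Rightarrow> complex poly) \<Rightarrow> real \<Rightarrow> complex" where
  "exp_poly_kernel M \<alpha> P t =
     (\<Sum>m=1..M. poly (P m) (complex_of_real t) * exp (- \<alpha> m * complex_of_real t))"


section \<open>The local counts attached to a real exponent\<close>

text \<open>The \<open>K\<close>-th derivative of a polynomial of degree \<open>K\<close> is constant, so it may be evaluated
  at \<open>0\<close>.\<close>

definition top_deriv :: "complex poly \<Rightarrow> real" where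
  "top_deriv P = Re (poly ((pderiv ^^ degree P) P) 0)"

definition local_plus :: "nat \<Rightarrow> real \<Rightarrow> nat" where
  "local_plus K p = (if odd K then (K + 1) div 2 else if p > 0 then K div 2 + 1 else K div 2)"

definition local_minus :: "nat \<Rightarrow> real \<Rightarrow> nat" where
  "local_minus K p = (if odd K then (K + 1) div 2 else if p < 0 then K div 2 + 1 else K div 2)"

end

theory Submission
  imports Defs "HOL-Computational_Algebra.Fundamental_Theorem_Algebra"
begin

text \<open>
  Expanding \<open>P_m(t + s)\<close> shows that \<open>H\<close> acts through a Hermitian matrix \<open>B\<close> on the linearly
  independent functions \<open>t^j exp (- \<alpha>_m t)\<close>, \<open>j \<le> K_m\<close>. By Sylvester's law of inertia its numbers
  of positive and negative eigenvalues are those of the form \<open>B\<close>. This form couples \<open>\<alpha>_m\<close> only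
  to its complex conjugate, and the corresponding block is antitriangular with a nonzero antidiagonal.
  Hence a pair of conjugate exponents, and for a real exponent each pair of indices \<open>j \<noteq> K_m - j\<close>,
  contributes hyperbolic planes only; what is left is the middle entry \<open>j = K_m / 2\<close> for a
  real exponent with even \<open>K_m\<close>, whose sign is that of the leading coefficient of \<open>P_m\<close>.
\<close>

section \<open>Systems of linear equations, inertia and exponential polynomials\<close>

text \<open>The functions \<open>\<psi> i\<close> are independent but not orthogonal, so the
  eigenvalues of \<open>H\<close> are not those of the matrix \<open>B\<close>; only the numbers of
  each sign agree. What the two share is the form \<open>cinner (H f) f\<close>, which is the form
  of \<open>B\<close> at the vector of the numbers \<open>cinner f (\<psi> k)\<close>. It is written
  as a weighted sum of squares twice, by a spectral decomposition of \<open>H\<close> and by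
  polarization in \<open>B\<close>, and a dimension count compares the signs of the weights. No
  eigenvalue is ever computed. Since \<open>N_plus\<close> and \<open>N_minus\<close> are defined
  through the spectrum and not through a form, the decomposition of \<open>H\<close> must also
  identify the spectrum away from 0, which is done with an explicit resolvent. Hyperbolic planes
  appear without any normal form for \<open>B\<close>: it suffices that \<open>B\<close> vanishes on
  one half of the indices and pairs that half injectively with the other. Whatever \<open>B\<close>
  does inside the other half is absorbed by a change of coordinates.\<close>

lemma homogeneous_system_solution:
  fixes A :: "'j \<Rightarrow> 'i \<Rightarrow> 'a::field"
  assumes "finite J" "finite I" "card J < card I"
  shows "\<exists>x. (\<exists>i\<in>I. x i \<noteq> 0) \<and> (\<forall>j\<in>J. (\<Sum>i\<in>I. A j i * x i) = 0)"
  using assms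
proof (induction J arbitrary: I A rule: finite_induct)
  case empty
  then have "I \<noteq> {}" by auto
  then show ?case by (intro exI[of _ "\<lambda>_. 1"]) auto
next
  case (insert j J)
  show ?case
  proof (cases "\<forall>i\<in>I. A j i = 0")
    case True
    obtain x where "\<exists>i\<in>I. x i \<noteq> 0" "\<forall>k\<in>J. (\<Sum>i\<in>I. A k i * x i) = 0"
      using insert.IH[of I A] insert.prems insert.hyps by auto
    with True show ?thesis by (intro exI[of _ x]) auto
  next
    case False
    then obtain p where p: "p \<in> I" "A j p \<noteq> 0" by blast
    \<comment> \<open>Gaussian elimination with pivot \<open>A j p\<close>: equation
      \<open>j\<close> is solved for the unknown \<open>p\<close> and substituted into the others.
      The definition of \<open>y\<close> restores the value at \<open>p\<close>.\<close>
    define A' where "A' = (\<lambda>k i. A k i - A k p * A j i / A j p)"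
    have "card J < card (I - {p})"
      using insert.prems insert.hyps p by simp
    then obtain x where x: "\<exists>i\<in>I - {p}. x i \<noteq> 0"
        "\<forall>k\<in>J. (\<Sum>i\<in>I - {p}. A' k i * x i) = 0"
      using insert.IH[of "I - {p}" A'] insert.prems by auto
    define s where "s = (\<Sum>i\<in>I - {p}. A j i * x i)"
    define y where "y = x(p := - s / A j p)"
    have split: "(\<Sum>i\<in>I. A k i * y i) = (\<Sum>i\<in>I - {p}. A k i * x i) - A k p * s / A j p" for k
    proof -
      have "(\<Sum>i\<in>I. A k i * y i) = A k p * y p + (\<Sum>i\<in>I - {p}. A k i * y i)"
        using p insert.prems by (intro sum.remove) auto
      also have "(\<Sum>i\<in>I - {p}. A k i * y i) = (\<Sum>i\<in>I - {p}. A k i * x i)"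
        by (intro sum.cong) (auto simp: y_def)
      finally show ?thesis by (simp add: y_def)
    qed
    have "(\<Sum>i\<in>I. A k i * y i) = 0" if "k \<in> J" for k
    proof -
      have "(\<Sum>i\<in>I - {p}. A' k i * x i)
          = (\<Sum>i\<in>I - {p}. A k i * x i) - A k p * s / A j p"
        by (simp add: A'_def s_def sum_subtractf sum_distrib_left sum_divide_distrib algebra_simps)
      with x(2) that show ?thesis by (simp add: split)
    qed
    moreover have "(\<Sum>i\<in>I. A j i * y i) = 0"
      using p by (simp add: split s_def)
    moreover have "\<exists>i\<in>I. y i \<noteq> 0" using x(1) by (auto simp: y_def)
    ultimately show ?thesis by (intro exI[of _ y]) auto
  qed
qed

text \<open>One half of Sylvester's law, by counting dimensions. Were there more positive \<mu> than
  positive \<nu>, killing the forms with negative \<mu> and those with positive \<nu> would cost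
  fewer than \<open>card I\<close> equations. A nonzero common solution makes the left side of
  \<open>eq\<close> nonnegative and the right side nonpositive, so every form \<open>A i\<close>
  vanishes on it, against \<open>inj\<close>. A second application with the roles exchanged gives
  the reverse inequality.\<close>

lemma card_positive_weights_le:
  fixes A :: "'i \<Rightarrow> 'i \<Rightarrow> complex" and C :: "'l \<Rightarrow> 'i \<Rightarrow> complex"
    and \<mu> :: "'i \<Rightarrow> real" and \<nu> :: "'l \<Rightarrow> real"
  assumes fin: "finite I" "finite L"
    and inj: "\<And>x. (\<forall>i\<in>I. (\<Sum>k\<in>I. A i k * x k) = 0) \<Longrightarrow> \<forall>k\<in>I. x k = 0"
    and eq: "\<And>x. (\<Sum>i\<in>I. \<mu> i * (cmod (\<Sum>k\<in>I. A i k * x k))\<^sup>2)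
                = (\<Sum>l\<in>L. \<nu> l * (cmod (\<Sum>k\<in>I. C l k * x k))\<^sup>2)"
    and nz: "\<And>i. i \<in> I \<Longrightarrow> \<mu> i \<noteq> 0"
  shows "card {i\<in>I. \<mu> i > 0} \<le> card {l\<in>L. \<nu> l > 0}"
proof (rule ccontr)
  assume "\<not> ?thesis"
  then have lt: "card {l\<in>L. \<nu> l > 0} < card {i\<in>I. \<mu> i > 0}" by simp
  define In where "In = {i\<in>I. \<mu> i < 0}"
  define Lp where "Lp = {l\<in>L. \<nu> l > 0}"
  have "I = {i\<in>I. \<mu> i > 0} \<union> In" using nz by (force simp: In_def)
  then have "card I = card ({i\<in>I. \<mu> i > 0} \<union> In)" by (rule arg_cong)
  also have "\<dots> = card {i\<in>I. \<mu> i > 0} + card In"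
    using fin by (intro card_Un_disjoint) (auto simp: In_def)
  \<comment> \<open>The disjoint sum joins the two families of equations into a single
    system.\<close>
  finally have "card (In <+> Lp) < card I"
    using lt fin by (simp add: card_Plus In_def Lp_def)
  moreover have "finite (In <+> Lp)" using fin by (simp add: In_def Lp_def)
  ultimately obtain x where x: "\<exists>i\<in>I. x i \<noteq> 0"
      "\<forall>j\<in>In <+> Lp. (\<Sum>i\<in>I. case_sum A C j i * x i) = 0"
    using homogeneous_system_solution[OF _ fin(1), of "In <+> Lp" "case_sum A C"] by blast
  have x1: "(\<Sum>k\<in>I. A i k * x k) = 0" if "i \<in> In" for i
    using bspec[OF x(2), of "Inl i"] that by auto
  have x2: "(\<Sum>k\<in>I. C l k * x k) = 0" if "l \<in> Lp" for l
    using bspec[OF x(2), of "Inr l"] that by auto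
  have nonneg: "0 \<le> \<mu> i * (cmod (\<Sum>k\<in>I. A i k * x k))\<^sup>2" if "i \<in> I" for i
    using x1[of i] that by (cases "i \<in> In") (auto simp: In_def)
  have "(\<Sum>l\<in>L. \<nu> l * (cmod (\<Sum>k\<in>I. C l k * x k))\<^sup>2) \<le> 0"
  proof (rule sum_nonpos)
    fix l assume "l \<in> L"
    then show "\<nu> l * (cmod (\<Sum>k\<in>I. C l k * x k))\<^sup>2 \<le> 0"
      using x2[of l] by (cases "l \<in> Lp") (auto simp: Lp_def mult_nonpos_nonneg)
  qed
  then have "(\<Sum>i\<in>I. \<mu> i * (cmod (\<Sum>k\<in>I. A i k * x k))\<^sup>2) = 0"
    using eq[of x] sum_nonneg[OF nonneg] by fastforce
  then have "\<forall>i\<in>I. \<mu> i * (cmod (\<Sum>k\<in>I. A i k * x k))\<^sup>2 = 0"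
    using sum_nonneg_eq_0_iff[OF fin(1) nonneg] by simp
  then have "\<forall>i\<in>I. (\<Sum>k\<in>I. A i k * x k) = 0" using nz by auto
  then show False using inj x(1) by blast
qed

section \<open>Linear independence of exponential polynomials\<close>

lemma has_vector_derivative_poly_exp:
  "((\<lambda>t. poly p (complex_of_real t) * exp (c * complex_of_real t)) has_vector_derivative
     poly (pderiv p + smult c p) (complex_of_real t) * exp (c * complex_of_real t)) (at t)"
proof -
  have "((\<lambda>z. poly p z * exp (c * z)) has_field_derivative
     poly (pderiv p + smult c p) (complex_of_real t) * exp (c * complex_of_real t))
     (at (complex_of_real t))"
    by (auto intro!: derivative_eq_intros simp: algebra_simps)
  then show ?thesis by (rule has_vector_derivative_real_field)
qed

text \<open>Differentiation replaces the coefficient \<open>p\<close> of an exponential with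
  exponent \<open>c\<close> by \<open>pderiv p + smult c p\<close>. As \<open>pderiv\<close> lowers
  the degree, the leading coefficient is just multiplied by \<open>c\<close>, so for nonzero
  \<open>c\<close> no information is lost.\<close>

lemma pderiv_add_smult_eq_0_D:
  fixes p :: "complex poly"
  assumes "pderiv p + smult c p = 0" "c \<noteq> 0"
  shows "p = 0"
proof (rule ccontr)
  assume "p \<noteq> 0"
  have "coeff (pderiv p + smult c p) (degree p) = c * lead_coeff p"
    by (simp add: coeff_pderiv coeff_eq_0)
  with assms \<open>p \<noteq> 0\<close> show False by simp
qed

text \<open>Dividing by one exponential turns its term into a plain polynomial, which repeated
  differentiation kills. The other coefficients pass through injective maps, so their vanishing can
  be traced back, and one exponent fewer is left.\<close>

lemma exp_poly_independent:
  fixes P :: "complex \<Rightarrow> complex poly"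
  assumes "finite A"
    and "\<And>t. t > 0 \<Longrightarrow>
      (\<Sum>a\<in>A. poly (P a) (complex_of_real t) * exp (a * complex_of_real t)) = 0"
  shows "\<forall>a\<in>A. P a = 0"
  using assms
proof (induction A arbitrary: P rule: finite_induct)
  case empty
  then show ?case by simp
next
  case (insert b A)
  \<comment> \<open>The exponent \<open>b\<close> is normalized to 0. The claim is made for all
    \<open>p\<close> and \<open>Q\<close> because the inner induction on \<open>degree p\<close>
    passes to the differentiated pair \<open>p'\<close>, \<open>Q'\<close>.\<close>
  have *: "p = 0 \<and> (\<forall>a\<in>A. Q a = 0)"
    if "\<And>t. t > 0 \<Longrightarrow> poly p (complex_of_real t)
        + (\<Sum>a\<in>A. poly (Q a) (complex_of_real t) * exp ((a - b) * complex_of_real t)) = 0"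
    for p Q
    using that
  proof (induction "degree p" arbitrary: p Q rule: less_induct)
    case less
    define p' where "p' = pderiv p"
    define Q' where "Q' = (\<lambda>a. pderiv (Q a) + smult (a - b) (Q a))"
    have zero: "poly p' (complex_of_real t)
        + (\<Sum>a\<in>A. poly (Q' a) (complex_of_real t) * exp ((a - b) * complex_of_real t)) = 0"
      if "t > 0" for t
    proof -
      let ?f = "\<lambda>t. poly p (complex_of_real t)
        + (\<Sum>a\<in>A. poly (Q a) (complex_of_real t) * exp ((a - b) * complex_of_real t))"
      have "(?f has_vector_derivative (poly p' (complex_of_real t)
          + (\<Sum>a\<in>A. poly (Q' a) (complex_of_real t) * exp ((a - b) * complex_of_real t)))) (at t)"
        unfolding Q'_def using has_vector_derivative_poly_exp[of p 0 t]
        by (intro has_vector_derivative_add has_vector_derivative_sum has_vector_derivative_poly_exp)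
           (simp add: p'_def)
      moreover have "(?f has_vector_derivative 0) (at t)"
        by (rule has_vector_derivative_transform_within_open[of "\<lambda>_. 0" _ _ "{0<..}"])
           (use that less.prems in auto)
      ultimately show ?thesis by (rule vector_derivative_unique_at)
    qed
    \<comment> \<open>For constant \<open>p\<close> the derivative has no polynomial term left and,
      multiplied by \<open>exp (b * t)\<close>, falls under the outer induction; otherwise the
      degree has dropped.\<close>
    have Q': "\<forall>a\<in>A. Q' a = 0"
    proof (cases "degree p = 0")
      case True
      then have "p' = 0" by (simp add: p'_def pderiv_eq_0_iff)
      have "\<forall>a\<in>A. Q' a = 0"
      proof (rule insert.IH)
        fix t :: real assume t: "t > 0"
        have "(\<Sum>a\<in>A. poly (Q' a) (complex_of_real t) * exp (a * complex_of_real t))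
            = exp (b * complex_of_real t) * (\<Sum>a\<in>A. poly (Q' a) (complex_of_real t)
                * exp ((a - b) * complex_of_real t))"
          unfolding sum_distrib_left by (intro sum.cong refl) (simp add: exp_diff left_diff_distrib)
        also have "\<dots> = 0" using zero[OF t] \<open>p' = 0\<close> by simp
        finally show "(\<Sum>a\<in>A. poly (Q' a) (complex_of_real t) * exp (a * complex_of_real t)) = 0" .
      qed
      then show ?thesis .
    next
      case False
      then have "degree p' < degree p" by (simp add: p'_def degree_pderiv)
      from less.hyps[OF this zero] show ?thesis by blast
    qed
    have Q: "\<forall>a\<in>A. Q a = 0"
    proof
      fix a assume "a \<in> A"
      then show "Q a = 0"
        using Q' insert.hyps(2) pderiv_add_smult_eq_0_D[of "Q a" "a - b"] by (auto simp: Q'_def)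
    qed
    have "poly p (complex_of_real t) = 0" if "t > 0" for t
      using less.prems[OF that] Q by simp
    then have "complex_of_real ` {0<..} \<subseteq> {z. poly p z = 0}" by auto
    moreover have "infinite (complex_of_real ` {0<..})"
      using finite_imageD[of complex_of_real "{0<..}"] infinite_Ioi[of "0::real"]
      by (auto simp: inj_on_def)
    ultimately have "p = 0" using poly_roots_finite[of p] finite_subset by blast
    with Q show ?case by blast
  qed
  have "P b = 0 \<and> (\<forall>a\<in>A. P a = 0)"
  proof (rule *)
    fix t :: real assume t: "t > 0"
    have "poly (P b) (complex_of_real t)
        + (\<Sum>a\<in>A. poly (P a) (complex_of_real t) * exp ((a - b) * complex_of_real t))
        = (\<Sum>a\<in>insert b A. poly (P a) (complex_of_real t) * exp (a * complex_of_real t))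
          * exp (- b * complex_of_real t)"
    proof -
      have e: "exp ((a - b) * complex_of_real t) = exp (a * complex_of_real t) * exp (- b * complex_of_real t)" for a
        by (simp flip: exp_add add: algebra_simps)
      have "exp (b * complex_of_real t) * exp (- b * complex_of_real t) = 1"
        by (simp flip: exp_add)
      then show ?thesis
        using insert.hyps by (simp add: e sum_distrib_right distrib_right mult.assoc)
    qed
    then show "poly (P b) (complex_of_real t)
        + (\<Sum>a\<in>A. poly (P a) (complex_of_real t) * exp ((a - b) * complex_of_real t)) = 0"
      using insert.prems[OF t] by simp
  qed
  then show ?case by simp
qed

section \<open>Symmetric finite-rank operators on the complex Hilbert space\<close>

text \<open>The product \<open>inner\<close> of the class instance is only the real part of this
  one. Coefficients in a complex orthonormal family need both parts.\<close>

lift_definition cinner :: "L2 \<Rightarrow> L2 \<Rightarrow> complex" is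
  "\<lambda>f g. \<integral>t. f t * cnj (g t) \<partial>half_line"
proof (elim conjE)
  fix f f' g g' :: "real \<Rightarrow> complex"
  assume sq: "square_integrable f" "square_integrable f'" "square_integrable g" "square_integrable g'"
    and ae: "AE t in half_line. f t = f' t" "AE t in half_line. g t = g' t"
  from ae have "AE t in half_line. f t * cnj (g t) = f' t * cnj (g' t)"
    by eventually_elim simp
  moreover have "(\<lambda>t. f t * cnj (g t)) \<in> borel_measurable half_line"
    and "(\<lambda>t. f' t * cnj (g' t)) \<in> borel_measurable half_line"
    using integrable_mult_cnj sq by (blast intro: borel_measurable_integrable)+
  ultimately show "(\<integral>t. f t * cnj (g t) \<partial>half_line) = (\<integral>t. f' t * cnj (g' t) \<partial>half_line)"
    using integral_cong_AE by metis
qed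

lemma Re_cinner: "Re (cinner f g) = inner f g"
  by transfer simp

lemma cinner_add_left: "cinner (f + g) k = cinner f k + cinner g k"
  by transfer (simp add: distrib_right integrable_mult_cnj)

lemma cinner_scaleC_left: "cinner (c *\<^sub>C f) g = c * cinner f g"
  by transfer (simp add: mult.assoc)

lemma cnj_cinner: "cnj (cinner f g) = cinner g f"
proof transfer
  fix f g :: "real \<Rightarrow> complex"
  have "cnj (\<integral>t. f t * cnj (g t) \<partial>half_line) = (\<integral>t. cnj (f t * cnj (g t)) \<partial>half_line)"
    by (simp only: Bochner_Integration.integral_cnj)
  then show "cnj (\<integral>t. f t * cnj (g t) \<partial>half_line) = (\<integral>t. g t * cnj (f t) \<partial>half_line)"
    by (simp add: mult.commute)
qed

lemma cinner_add_right: "cinner f (g + k) = cinner f g + cinner f k"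
  by (metis cnj_cinner cinner_add_left complex_cnj_add)

lemma cinner_scaleC_right: "cinner f (c *\<^sub>C g) = cnj c * cinner f g"
  by (metis cnj_cinner cinner_scaleC_left complex_cnj_mult)

lemma cinner_zero_left [simp]: "cinner 0 f = 0"
  using cinner_scaleC_left[of 0 0 f] by simp

lemma cinner_zero_right [simp]: "cinner f 0 = 0"
  using cinner_scaleC_right[of f 0 0] by simp

lemma cinner_sum_left: "cinner (\<Sum>i\<in>I. f i) g = (\<Sum>i\<in>I. cinner (f i) g)"
  by (induction I rule: infinite_finite_induct) (simp_all add: cinner_add_left)

lemma cinner_sum_right: "cinner g (\<Sum>i\<in>I. f i) = (\<Sum>i\<in>I. cinner g (f i))"
  by (induction I rule: infinite_finite_induct) (simp_all add: cinner_add_right)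

lemma scaleR_eq_scaleC: "r *\<^sub>R f = complex_of_real r *\<^sub>C f"
  by transfer (auto intro: square_integrable_mult_left)

lemma cinner_diff_left: "cinner (f - g) k = cinner f k - cinner g k"
  using cinner_add_left[of "f - g" g k] by simp

lemma cinner_diff_right: "cinner k (f - g) = cinner k f - cinner k g"
  using cinner_add_right[of k "f - g" g] by simp

lemmas cinner_simps = cinner_add_left cinner_add_right cinner_diff_left cinner_diff_right
  cinner_scaleC_left cinner_scaleC_right cinner_sum_left cinner_sum_right

lemma cinner_self: "cinner f f = complex_of_real ((norm f)\<^sup>2)"
proof -
  have "Im (cinner f f) = 0"
    using arg_cong[OF cnj_cinner[of f f], of Im] by simp
  then show ?thesis
    by (simp add: complex_eq_iff Re_cinner power2_norm_eq_inner)
qed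

lemma cinner_self_eq_0 [simp]: "cinner f f = 0 \<longleftrightarrow> f = 0"
  by (simp add: cinner_self)

lemma norm_scaleC: "norm (c *\<^sub>C f) = cmod c * norm f"
proof -
  have "complex_of_real ((norm (c *\<^sub>C f))\<^sup>2) = complex_of_real ((cmod c * norm f)\<^sup>2)"
    unfolding cinner_self[symmetric] cinner_scaleC_left cinner_scaleC_right
    by (simp add: cinner_self power_mult_distrib complex_norm_square mult_ac del: of_real_power)
  then have "(norm (c *\<^sub>C f))\<^sup>2 = (cmod c * norm f)\<^sup>2"
    by (simp only: of_real_eq_iff)
  then show ?thesis by (simp add: power2_eq_iff_nonneg)
qed

text \<open>Multiplying \<open>f\<close> by a number of modulus 1 makes the product real and
  nonnegative, so the real Cauchy-Schwarz inequality for \<open>inner\<close> applies.\<close>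

lemma norm_cinner_le: "cmod (cinner f g) \<le> norm f * norm g"
proof (cases "cinner f g = 0")
  case False
  define c where "c = cnj (cinner f g) / cmod (cinner f g)"
  have c: "cmod c = 1" using False by (simp add: c_def norm_divide)
  have "complex_of_real (cmod (cinner f g)) = c * cinner f g"
    using False by (simp add: c_def mult.commute complex_norm_square[symmetric] power2_eq_square)
  also have "\<dots> = cinner (c *\<^sub>C f) g" by (simp add: cinner_simps)
  finally have "cmod (cinner f g) = inner (c *\<^sub>C f) g"
    by (metis Re_cinner Re_complex_of_real)
  also have "\<dots> \<le> norm (c *\<^sub>C f) * norm g" by (rule norm_cauchy_schwarz)
  finally show ?thesis using c by (simp add: norm_scaleC)
qed simp

abbreviation clinear :: "(L2 \<Rightarrow> L2) \<Rightarrow> bool" where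
  "clinear \<equiv> Vector_Spaces.linear scaleC scaleC"

lemma clinearI:
  assumes "\<And>f g. T (f + g) = T f + T g" "\<And>c f. T (c *\<^sub>C f) = c *\<^sub>C T f"
  shows "clinear T"
  using assms by unfold_locales auto

lemma clinear_add: "clinear T \<Longrightarrow> T (f + g) = T f + T g"
  by (simp add: Vector_Spaces.linear_iff)

lemma clinear_scaleC: "clinear T \<Longrightarrow> T (c *\<^sub>C f) = c *\<^sub>C T f"
  by (simp add: Vector_Spaces.linear_iff)

lemma clinear_zero: "clinear T \<Longrightarrow> T 0 = 0"
  using clinear_scaleC[of T 0 0] by simp

lemma clinear_sum: "clinear T \<Longrightarrow> T (\<Sum>i\<in>I. f i) = (\<Sum>i\<in>I. T (f i))"
  by (induction I rule: infinite_finite_induct) (simp_all add: clinear_add clinear_zero)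

section \<open>Eigenvectors and diagonalization of symmetric operators of finite rank\<close>

definition poly_op :: "(L2 \<Rightarrow> L2) \<Rightarrow> complex poly \<Rightarrow> L2 \<Rightarrow> L2" where
  "poly_op T p f = (\<Sum>i\<le>degree p. coeff p i *\<^sub>C (T ^^ i) f)"

lemma poly_op_bound:
  assumes "degree p \<le> n"
  shows "poly_op T p f = (\<Sum>i\<le>n. coeff p i *\<^sub>C (T ^^ i) f)"
  unfolding poly_op_def using assms
  by (intro sum.mono_neutral_left) (auto simp: coeff_eq_0)

lemma poly_op_linear_factor:
  assumes "clinear T"
  shows "poly_op T ([:-z, 1:] * q) f = T (poly_op T q f) - z *\<^sub>C poly_op T q f"
proof -
  define n where "n = degree q"
  have "degree ([:-z, 1:] * q) \<le> Suc n"
    unfolding n_def by (rule order_trans[OF degree_mult_le]) simp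
  then have "poly_op T ([:-z, 1:] * q) f
      = (\<Sum>i\<le>Suc n. coeff ([:-z, 1:] * q) i *\<^sub>C (T ^^ i) f)"
    by (rule poly_op_bound)
  also have "\<dots> = (\<Sum>i\<le>Suc n. coeff (pCons 0 q) i *\<^sub>C (T ^^ i) f)
      - (\<Sum>i\<le>Suc n. z *\<^sub>C coeff q i *\<^sub>C (T ^^ i) f)"
    unfolding sum_subtractf[symmetric]
    by (intro sum.cong refl) (simp add: L2.scale_left_diff_distrib L2.scale_left_distrib)
  also have "(\<Sum>i\<le>Suc n. coeff (pCons 0 q) i *\<^sub>C (T ^^ i) f)
      = (\<Sum>i\<le>n. coeff q i *\<^sub>C T ((T ^^ i) f))"
    by (subst sum.atMost_Suc_shift) simp
  also have "\<dots> = T (poly_op T q f)"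
    using assms by (simp add: poly_op_def n_def clinear_sum clinear_scaleC)
  also have "(\<Sum>i\<le>Suc n. z *\<^sub>C coeff q i *\<^sub>C (T ^^ i) f) = z *\<^sub>C poly_op T q f"
    by (subst poly_op_bound[of q "Suc n"]) (simp_all add: n_def L2.scale_sum_right del: sum.atMost_Suc)
  finally show ?thesis .
qed

text \<open>The iterates with index up to \<open>card S\<close> are one more than the vectors whose
  span contains them; a nontrivial linear relation between them supplies the coefficients of
  \<open>p\<close>.\<close>

lemma annihilating_poly:
  assumes "finite S" "\<And>i. (T ^^ i) f \<in> L2.span S"
  shows "\<exists>p. p \<noteq> 0 \<and> poly_op T p f = 0"
proof -
  have "\<forall>i. \<exists>r. (T ^^ i) f = (\<Sum>s\<in>S. r s *\<^sub>C s)"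
    using assms by (auto simp: L2.span_finite)
  then obtain r where r: "\<And>i. (T ^^ i) f = (\<Sum>s\<in>S. r i s *\<^sub>C s)" by metis
  obtain x where x: "\<exists>i\<le>card S. x i \<noteq> 0" "\<forall>s\<in>S. (\<Sum>i\<le>card S. r i s * x i) = 0"
    using homogeneous_system_solution[of S "{..card S}" "\<lambda>s i. r i s"] assms(1) by auto
  define p where "p = (\<Sum>i\<le>card S. monom (x i) i)"
  have coeff: "coeff p k = (if k \<le> card S then x k else 0)" for k
    by (simp add: p_def coeff_sum)
  have "p \<noteq> 0" using x(1) coeff by (metis coeff_0)
  have "degree p \<le> card S"
    by (rule degree_le) (simp add: coeff)
  then have "poly_op T p f = (\<Sum>i\<le>card S. x i *\<^sub>C (T ^^ i) f)"
    by (simp add: poly_op_bound coeff)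
  also have "\<dots> = (\<Sum>s\<in>S. (\<Sum>i\<le>card S. r i s * x i) *\<^sub>C s)"
    unfolding r L2.scale_sum_right L2.scale_sum_left
    by (subst sum.swap) (simp add: mult.commute)
  also have "\<dots> = 0" using x(2) by simp
  finally show ?thesis using \<open>p \<noteq> 0\<close> by blast
qed

text \<open>Take \<open>p\<close> of least degree annihilating \<open>T f0\<close> and split off a
  root \<open>z\<close>. By minimality the cofactor does not annihilate \<open>T f0\<close>, and
  what it produces is an eigenvector \<open>w\<close> for \<open>z\<close>; symmetry makes
  \<open>z\<close> real. Starting from \<open>T f0\<close> instead of \<open>f0\<close> keeps
  \<open>w\<close> in the range of \<open>T\<close>, and this excludes \<open>z = 0\<close>: if
  \<open>w = T u\<close>, then \<open>cinner w w = cinner u (T w)\<close>.\<close>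

lemma symmetric_eigenvector:
  assumes lin: "clinear T" and sym: "\<And>f g. cinner (T f) g = cinner f (T g)"
    and S: "finite S" "range T \<subseteq> L2.span S" and nz: "T f0 \<noteq> 0"
  shows "\<exists>w \<kappa>. w \<noteq> 0 \<and> \<kappa> \<noteq> 0 \<and> T w = complex_of_real \<kappa> *\<^sub>C w"
proof -
  have it: "(T ^^ i) (T f0) = T ((T ^^ i) f0)" for i
    by (rule funpow_swap1[symmetric])
  then have "\<exists>p. p \<noteq> 0 \<and> poly_op T p (T f0) = 0"
    using annihilating_poly[OF S(1)] S(2) by (metis it range_subsetD)
  then obtain p where p: "p \<noteq> 0" "poly_op T p (T f0) = 0"
      and min: "\<And>q. q \<noteq> 0 \<Longrightarrow> poly_op T q (T f0) = 0 \<Longrightarrow> degree p \<le> degree q"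
    using ex_has_least_nat[of "\<lambda>p. p \<noteq> 0 \<and> poly_op T p (T f0) = 0" _ degree] by blast
  have "degree p \<noteq> 0"
  proof
    assume "degree p = 0"
    then obtain c where "p = [:c:]" by (rule degree_eq_zeroE)
    with p nz show False by (simp add: poly_op_def)
  qed
  then obtain z where "poly p z = 0"
    using fundamental_theorem_of_algebra[of p] constant_degree[of p] by auto
  then obtain q where q: "p = [:-z, 1:] * q" by (auto simp: poly_eq_0_iff_dvd dvd_def)
  have "q \<noteq> 0" using p q by auto
  then have "degree p = Suc (degree q)" unfolding q by (subst degree_mult_eq) auto
  define w where "w = poly_op T q (T f0)"
  have w: "w \<noteq> 0" using min[OF \<open>q \<noteq> 0\<close>] \<open>degree p = Suc (degree q)\<close> by (auto simp: w_def)
  have Tw: "T w = z *\<^sub>C w"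
    using p(2) poly_op_linear_factor[OF lin, of z q "T f0"] by (simp add: q w_def)
  have "z * cinner w w = cnj z * cinner w w"
    using sym[of w w] by (simp add: Tw cinner_simps)
  then have "z = cnj z" using w by (metis cinner_self_eq_0 mult_cancel_right)
  then have z: "z = complex_of_real (Re z)"
    by (simp add: complex_eq_iff)
  have "z \<noteq> 0"
  proof
    assume "z = 0"
    have "\<exists>u. w = T u"
    proof -
      have "w = T (poly_op T q f0)"
        using lin by (simp add: w_def poly_op_def clinear_sum clinear_scaleC it)
      then show ?thesis ..
    qed
    then obtain u where u: "w = T u" ..
    have "cinner w w = cinner u (T w)" by (metis sym u)
    then show False using w Tw \<open>z = 0\<close> by simp
  qed
  then show ?thesis using w Tw z by (metis of_real_0)
qed

definition orthonormal :: "L2 set \<Rightarrow> bool" where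
  "orthonormal E \<longleftrightarrow> (\<forall>e\<in>E. \<forall>e'\<in>E. cinner e e' = (if e = e' then 1 else 0))"

lemma cinner_orthonormal_sum:
  assumes "orthonormal E" "finite E" "e \<in> E"
  shows "cinner (\<Sum>e'\<in>E. c e' *\<^sub>C e') e = c e"
proof -
  have "cinner (\<Sum>e'\<in>E. c e' *\<^sub>C e') e = (\<Sum>e'\<in>E. if e' = e then c e' else 0)"
    unfolding cinner_sum_left cinner_scaleC_left
    using assms by (intro sum.cong) (auto simp: orthonormal_def)
  then show ?thesis using assms by simp
qed

lemma orthonormal_independent:
  assumes "orthonormal E"
  shows "L2.independent E"
  unfolding L2.independent_explicit_module
proof (intro allI impI)
  fix t u v
  assume *: "finite t" "t \<subseteq> E" "(\<Sum>v\<in>t. u v *\<^sub>C v) = 0" "v \<in> t"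
  moreover have "orthonormal t" using assms *(2) unfolding orthonormal_def by blast
  ultimately show "u v = 0" using cinner_orthonormal_sum[of t v u] by simp
qed

text \<open>A largest orthonormal set \<open>E\<close> of eigenvectors with nonzero eigenvalues
  already carries all of \<open>T\<close>: an eigenvector of the remainder could be added to
  \<open>E\<close>.\<close>

lemma symmetric_diagonalization:
  assumes lin: "clinear T" and sym: "\<And>f g. cinner (T f) g = cinner f (T g)"
    and S: "finite S" "range T \<subseteq> L2.span S"
  obtains E \<kappa> where "finite E" "orthonormal E" "\<And>e. e \<in> E \<Longrightarrow> \<kappa> e \<noteq> (0::real)"
    "\<And>f. T f = (\<Sum>e\<in>E. (complex_of_real (\<kappa> e) * cinner f e) *\<^sub>C e)"
proof -
  define good where "good = (\<lambda>E. finite E \<and> orthonormal E \<and>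
    (\<forall>e\<in>E. \<exists>\<kappa>. \<kappa> \<noteq> 0 \<and> T e = complex_of_real \<kappa> *\<^sub>C e))"
  \<comment> \<open>Eigenvectors for nonzero eigenvalues lie in the range of \<open>T\<close>. Being
    independent, there are at most \<open>card S\<close> of them, so a largest \<open>E\<close>
    exists.\<close>
  have bound: "card E \<le> card S" if "good E" for E
  proof -
    have "e \<in> L2.span S" if "e \<in> E" for e
    proof -
      obtain \<kappa> where \<kappa>: "\<kappa> \<noteq> 0" "T e = complex_of_real \<kappa> *\<^sub>C e"
        using \<open>good E\<close> \<open>e \<in> E\<close> unfolding good_def by blast
      then have "e = (1 / complex_of_real \<kappa>) *\<^sub>C T e" by simp
      then show ?thesis using S(2) L2.span_scale by (metis range_subsetD)
    qed
    then show ?thesis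
      using L2.independent_span_bound[OF S(1), of E] orthonormal_independent that
      by (auto simp: good_def)
  qed
  have "good {}" by (simp add: good_def orthonormal_def)
  then obtain E where E: "good E" and max: "\<And>E'. good E' \<Longrightarrow> card E' \<le> card E"
    using ex_has_greatest_nat[of good "{}" card "Suc (card S)"] bound by (metis le_imp_less_Suc)
  then obtain \<kappa> where \<kappa>: "\<And>e. e \<in> E \<Longrightarrow> \<kappa> e \<noteq> 0 \<and> T e = complex_of_real (\<kappa> e) *\<^sub>C e"
    unfolding good_def by metis
  have fin: "finite E" and on: "orthonormal E" using E by (auto simp: good_def)
  define D where "D = (\<lambda>f. \<Sum>e\<in>E. (complex_of_real (\<kappa> e) * cinner f e) *\<^sub>C e)"
  \<comment> \<open>Deflation: \<open>T'\<close> is symmetric, maps into the same span and kills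
    every element of \<open>E\<close>.\<close>
  define T' where "T' = (\<lambda>f. T f - D f)"
  have "T' f = 0" for f
  proof (rule ccontr)
    assume f: "T' f \<noteq> 0"
    have "clinear T'"
      by (rule clinearI) (simp_all add: T'_def D_def clinear_add[OF lin] clinear_scaleC[OF lin]
        cinner_simps distrib_left L2.scale_left_distrib sum.distrib L2.scale_right_diff_distrib
        L2.scale_sum_right mult_ac)
    moreover have "cinner (T' f) g = cinner f (T' g)" for f g
      by (simp add: T'_def D_def cinner_simps sym cnj_cinner mult_ac)
    moreover have "range T' \<subseteq> L2.span S"
    proof -
      have E_span: "e \<in> L2.span S" if "e \<in> E" for e
      proof -
        have "e = (1 / complex_of_real (\<kappa> e)) *\<^sub>C T e" using \<kappa>[OF that] by simp
        then show ?thesis using S(2) L2.span_scale by (metis range_subsetD)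
      qed
      then show ?thesis using S(2)
        by (auto simp: T'_def D_def intro!: L2.span_diff L2.span_sum L2.span_scale)
    qed
    ultimately obtain w \<nu> where w: "w \<noteq> 0" "\<nu> \<noteq> 0" "T' w = complex_of_real \<nu> *\<^sub>C w"
      using symmetric_eigenvector[of T' S f] S(1) f by blast
    have T'_E: "T' e = 0" if "e \<in> E" for e
    proof -
      have "D e = (\<Sum>e'\<in>E. if e' = e then complex_of_real (\<kappa> e) *\<^sub>C e else 0)"
        unfolding D_def using on that by (intro sum.cong) (auto simp: orthonormal_def)
      then show ?thesis using \<kappa>[OF that] that fin by (simp add: T'_def)
    qed
    \<comment> \<open>Eigenvectors of \<open>T'\<close> for a nonzero eigenvalue are orthogonal to
      its kernel, hence to \<open>E\<close>. There \<open>D\<close> vanishes, so \<open>w\<close> is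
      an eigenvector of \<open>T\<close> as well.\<close>
    have orth: "cinner w e = 0" if "e \<in> E" for e
    proof -
      have "complex_of_real \<nu> * cinner w e = cinner w (T' e)"
        by (metis \<open>\<And>g f. cinner (T' f) g = cinner f (T' g)\<close> cinner_scaleC_left w(3))
      then show ?thesis using w T'_E[OF that] by simp
    qed
    then have "D w = 0" by (simp add: D_def)
    then have Tw: "T w = complex_of_real \<nu> *\<^sub>C w" using w(3) by (simp add: T'_def)
    define v where "v = complex_of_real (1 / norm w) *\<^sub>C w"
    have v1: "cinner v v = 1"
      using w(1) by (simp add: v_def cinner_self norm_scaleC norm_divide)
    have v0: "cinner v e = 0" "cinner e v = 0" if "e \<in> E" for e
      using orth[OF that] cnj_cinner[of v e] by (auto simp: v_def cinner_simps)
    have "T v = complex_of_real \<nu> *\<^sub>C v"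
      using Tw by (simp add: v_def clinear_scaleC[OF lin] mult.commute)
    have "v \<notin> E" using v0 v1 by force
    have "orthonormal (insert v E)"
      using on v0 v1 \<open>v \<notin> E\<close> by (auto simp: orthonormal_def)
    then have "good (insert v E)"
      using E w(2) \<open>T v = _\<close> by (auto simp: good_def)
    then show False using max[of "insert v E"] fin \<open>v \<notin> E\<close> by simp
  qed
  then have "T f = (\<Sum>e\<in>E. (complex_of_real (\<kappa> e) * cinner f e) *\<^sub>C e)" for f
    by (simp add: T'_def D_def)
  then show ?thesis using that[of E \<kappa>] fin on \<kappa> by blast
qed

text \<open>Away from 0 the spectrum is the set of values of \<kappa>, and each eigenspace is
  spanned by the matching elements of \<open>E\<close>, so the multiplicities add up to a number of
  elements of \<open>E\<close>. The point 0 is excluded because its eigenspace, the orthogonal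
  complement of \<open>E\<close>, is not visible in \<open>E\<close>.\<close>

lemma spectral_count_diagonal:
  assumes fin: "finite E" and on: "orthonormal E" and nz: "\<And>e. e \<in> E \<Longrightarrow> \<kappa> e \<noteq> (0::real)"
    and T: "\<And>f. T f = (\<Sum>e\<in>E. (complex_of_real (\<kappa> e) * cinner f e) *\<^sub>C e)"
    and S: "0 \<notin> S"
  shows "spectral_count T S = enat (card {e\<in>E. \<kappa> e \<in> S})"
proof -
  have Te: "T e = complex_of_real (\<kappa> e) *\<^sub>C e" if "e \<in> E" for e
  proof -
    have "T e = (\<Sum>e'\<in>E. if e' = e then complex_of_real (\<kappa> e) *\<^sub>C e else 0)"
      unfolding T using on that by (intro sum.cong) (auto simp: orthonormal_def)
    then show ?thesis using that fin by simp
  qed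
  have e0: "e \<noteq> 0" if "e \<in> E" for e using on that by (force simp: orthonormal_def)
  have cinner_T: "cinner (T f) e = complex_of_real (\<kappa> e) * cinner f e" if "e \<in> E" for f e
    unfolding T by (rule cinner_orthonormal_sum[OF on fin that])
  have spec: "complex_of_real x \<in> spectrum T \<longleftrightarrow> x \<in> \<kappa> ` E" if "x \<noteq> 0" for x
  proof
    assume "x \<in> \<kappa> ` E"
    then obtain e where e: "e \<in> E" "x = \<kappa> e" by blast
    show "complex_of_real x \<in> spectrum T"
      unfolding spectrum_def
    proof (clarify)
      fix R assume R: "bounded_linear R" "\<forall>f. R (T f - complex_of_real x *\<^sub>C f) = f"
      \<comment> \<open>A left inverse would have to send \<open>T e - x *\<^sub>C e = 0\<close>
        back to \<open>e\<close>.\<close>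
      have "e = R 0" using R(2) Te[OF e(1)] e(2) by (metis diff_self)
      also have "\<dots> = 0" using R(1) by (simp add: linear_simps)
      finally show False using e0[OF e(1)] by simp
    qed
  next
    assume spec: "complex_of_real x \<in> spectrum T"
    show "x \<in> \<kappa> ` E"
    proof (rule ccontr)
      assume x: "x \<notin> \<kappa> ` E"
      \<comment> \<open>The resolvent must act as \<open>1 / (\<kappa> e - x)\<close> on
        \<open>e\<close> and as \<open>- 1 / x\<close> on the orthogonal complement of
        \<open>E\<close>. The choice of \<open>c\<close> is the solution of
        \<open>(c e - 1) / x = 1 / (\<kappa> e - x)\<close>.\<close>
      define c where "c = (\<lambda>e. complex_of_real (\<kappa> e / (\<kappa> e - x)))"
      define R where "R = (\<lambda>f. complex_of_real (1 / x) *\<^sub>C ((\<Sum>e\<in>E. (c e * cinner f e) *\<^sub>C e) - f))"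
      have "bounded_linear R"
      proof (rule bounded_linear_intro[where K = "\<bar>1 / x\<bar> * ((\<Sum>e\<in>E. cmod (c e) * norm e * norm e) + 1)"])
        show "R (f + g) = R f + R g" for f g
          by (simp add: R_def cinner_simps distrib_left L2.scale_left_distrib sum.distrib
              L2.scale_right_distrib L2.scale_right_diff_distrib)
        show "R (r *\<^sub>R f) = r *\<^sub>R R f" for r f
          by (simp add: R_def scaleR_eq_scaleC cinner_simps
              L2.scale_right_diff_distrib L2.scale_sum_right mult_ac)
        fix f
        have "norm (\<Sum>e\<in>E. (c e * cinner f e) *\<^sub>C e) \<le> (\<Sum>e\<in>E. (cmod (c e) * norm e * norm e) * norm f)"
        proof (rule sum_norm_le)
          fix e
          have "cmod (c e) * (cmod (cinner f e) * norm e) \<le> cmod (c e) * ((norm f * norm e) * norm e)"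
            by (intro mult_left_mono mult_right_mono norm_cinner_le) auto
          then show "norm ((c e * cinner f e) *\<^sub>C e) \<le> cmod (c e) * norm e * norm e * norm f"
            by (simp add: norm_scaleC norm_mult mult_ac)
        qed
        then have "norm ((\<Sum>e\<in>E. (c e * cinner f e) *\<^sub>C e) - f)
            \<le> ((\<Sum>e\<in>E. cmod (c e) * norm e * norm e) + 1) * norm f"
          by (intro order_trans[OF norm_triangle_ineq4]) (simp add: sum_distrib_right distrib_right)
        from mult_left_mono[OF this, of "\<bar>1 / x\<bar>"]
        show "norm (R f) \<le> norm f * (\<bar>1 / x\<bar> * ((\<Sum>e\<in>E. cmod (c e) * norm e * norm e) + 1))"
          by (simp add: R_def norm_scaleC norm_divide mult_ac)
      qed
      moreover have "R (T f - complex_of_real x *\<^sub>C f) = f" for f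
      proof -
        have "(\<Sum>e\<in>E. (c e * cinner (T f - complex_of_real x *\<^sub>C f) e) *\<^sub>C e) = T f"
          unfolding T[of f]
        proof (intro sum.cong refl arg_cong2[of _ _ _ _ scaleC])
          fix e assume e: "e \<in> E"
          then have "\<kappa> e - x \<noteq> 0" using x by auto
          have "cinner (T f - complex_of_real x *\<^sub>C f) e = complex_of_real (\<kappa> e - x) * cinner f e"
            by (simp add: cinner_simps cinner_T[OF e] left_diff_distrib)
          then show "c e * cinner ((\<Sum>e\<in>E. (complex_of_real (\<kappa> e) * cinner f e) *\<^sub>C e) - complex_of_real x *\<^sub>C f) e
              = complex_of_real (\<kappa> e) * cinner f e"
            using \<open>\<kappa> e - x \<noteq> 0\<close> unfolding T[symmetric] by (simp add: c_def)
        qed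
        then show ?thesis using that by (simp add: R_def)
      qed
      moreover have "T (R f) - complex_of_real x *\<^sub>C R f = f" for f
      proof -
        define g where "g = (\<Sum>e\<in>E. (c e * cinner f e) *\<^sub>C e)"
        have "T (R f) = g"
          unfolding T g_def
        proof (intro sum.cong refl arg_cong2[of _ _ _ _ scaleC])
          fix e assume e: "e \<in> E"
          then have nz: "\<kappa> e - x \<noteq> 0" using x by auto
          have "cinner (R f) e = complex_of_real (1 / x) * (c e * cinner f e - cinner f e)"
            by (simp add: R_def cinner_scaleC_left cinner_diff_left cinner_orthonormal_sum[OF on fin e])
          also have "\<dots> = complex_of_real (1 / x * (\<kappa> e / (\<kappa> e - x) - 1)) * cinner f e"
            by (simp add: c_def algebra_simps)
          also have "1 / x * (\<kappa> e / (\<kappa> e - x) - 1) = 1 / (\<kappa> e - x)"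
            using nz that by (simp add: field_simps)
          finally show "complex_of_real (\<kappa> e) * cinner (R f) e = c e * cinner f e"
            by (simp add: c_def)
        qed
        moreover have "complex_of_real x *\<^sub>C R f = g - f"
          using that by (simp add: R_def g_def)
        ultimately show ?thesis by simp
      qed
      ultimately show False using spec unfolding spectrum_def by blast
    qed
  qed
  have mult: "multiplicity_of T (complex_of_real x) = enat (card {e\<in>E. \<kappa> e = x})" if "x \<noteq> 0" for x
  proof -
    have eq: "{f. T f = complex_of_real x *\<^sub>C f} = L2.span {e\<in>E. \<kappa> e = x}"
    proof (intro equalityI subsetI)
      fix f assume "f \<in> {f. T f = complex_of_real x *\<^sub>C f}"
      then have f: "T f = complex_of_real x *\<^sub>C f" by simp
      \<comment> \<open>As \<open>x\<close> is nonzero, \<open>f\<close> inherits the expansion of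
        \<open>T f\<close> in \<open>E\<close>, and comparing coefficients leaves only the terms
        with \<open>\<kappa> e = x\<close>.\<close>
      then have f': "f = complex_of_real (1 / x) *\<^sub>C T f" using that by simp
      have "T f \<in> L2.span {e\<in>E. \<kappa> e = x}"
        unfolding T
      proof (rule L2.span_sum)
        fix e assume e: "e \<in> E"
        have "complex_of_real (\<kappa> e) * cinner f e = complex_of_real x * cinner f e"
          unfolding cinner_T[OF e, symmetric] f by (rule cinner_scaleC_left)
        then have "\<kappa> e = x \<or> cinner f e = 0" by (metis mult_cancel_right of_real_eq_iff)
        then show "(complex_of_real (\<kappa> e) * cinner f e) *\<^sub>C e \<in> L2.span {e\<in>E. \<kappa> e = x}"
          using e by (auto intro: L2.span_scale L2.span_base L2.span_zero)
      qed
      then show "f \<in> L2.span {e\<in>E. \<kappa> e = x}" by (subst f') (rule L2.span_scale)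
    next
      fix f assume "f \<in> L2.span {e\<in>E. \<kappa> e = x}"
      then obtain r where f: "f = (\<Sum>e\<in>{e\<in>E. \<kappa> e = x}. r e *\<^sub>C e)"
        using fin by (auto simp: L2.span_finite)
      have f': "f = (\<Sum>e\<in>E. (if \<kappa> e = x then r e else 0) *\<^sub>C e)"
        unfolding f using fin by (intro sum.mono_neutral_cong_left) auto
      have "T f = (\<Sum>e\<in>E. (complex_of_real x * (if \<kappa> e = x then r e else 0)) *\<^sub>C e)"
        unfolding T
      proof (intro sum.cong refl)
        fix e assume e: "e \<in> E"
        show "(complex_of_real (\<kappa> e) * cinner f e) *\<^sub>C e
            = (complex_of_real x * (if \<kappa> e = x then r e else 0)) *\<^sub>C e"
          unfolding f' using cinner_orthonormal_sum[OF on fin e, of "\<lambda>e. if \<kappa> e = x then r e else 0"]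
          by simp
      qed
      also have "\<dots> = complex_of_real x *\<^sub>C f"
        unfolding f' by (simp add: L2.scale_sum_right)
      finally show "f \<in> {f. T f = complex_of_real x *\<^sub>C f}" by simp
    qed
    have "L2.independent {e\<in>E. \<kappa> e = x}"
      by (rule orthonormal_independent) (use on in \<open>auto simp: orthonormal_def\<close>)
    moreover have "\<exists>B. finite B \<and> L2.span {e\<in>E. \<kappa> e = x} \<subseteq> L2.span B"
      using fin by (intro exI[of _ "{e\<in>E. \<kappa> e = x}"]) auto
    ultimately show ?thesis
      unfolding multiplicity_of_def Let_def eq by (simp add: L2.dim_eq_card_independent)
  qed
  have \<Lambda>: "{x \<in> S. complex_of_real x \<in> spectrum T} = S \<inter> \<kappa> ` E"
  proof (rule set_eqI)
    fix x show "x \<in> {x \<in> S. complex_of_real x \<in> spectrum T} \<longleftrightarrow> x \<in> S \<inter> \<kappa> ` E"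
      using spec[of x] S by (cases "x = 0") auto
  qed
  have "spectral_count T S = (\<Sum>x\<in>S \<inter> \<kappa> ` E. multiplicity_of T (complex_of_real x))"
    unfolding spectral_count_def Let_def \<Lambda> using fin by simp
  also have "\<dots> = (\<Sum>x\<in>S \<inter> \<kappa> ` E. enat (card {e\<in>E. \<kappa> e = x}))"
    using S by (intro sum.cong refl mult) auto
  also have "\<dots> = enat (\<Sum>x\<in>S \<inter> \<kappa> ` E. card {e\<in>E. \<kappa> e = x})"
    unfolding of_nat_eq_enat[symmetric] by (rule of_nat_sum[symmetric])
  also have "(\<Sum>x\<in>S \<inter> \<kappa> ` E. card {e\<in>E. \<kappa> e = x}) = card (\<Union>x\<in>S \<inter> \<kappa> ` E. {e\<in>E. \<kappa> e = x})"
    using fin by (intro card_UN_disjoint[symmetric]) auto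
  also have "(\<Union>x\<in>S \<inter> \<kappa> ` E. {e\<in>E. \<kappa> e = x}) = {e\<in>E. \<kappa> e \<in> S}" by auto
  finally show ?thesis .
qed

section \<open>Inertia of a finite-rank operator given by a Hermitian matrix\<close>

text \<open>Both the weights \<mu> and the eigenvalues of \<open>H\<close> diagonalize the form
  \<open>cinner (H f) f\<close>. Restricting \<open>f\<close> to the span of the
  \<open>\<psi> k\<close> gives one inequality between the counts, restricting it to the span of the
  eigenvectors gives the other.\<close>

lemma finite_rank_inertia:
  fixes \<psi> :: "'i \<Rightarrow> L2" and B D :: "'i \<Rightarrow> 'i \<Rightarrow> complex" and \<mu> :: "'i \<Rightarrow> real"
  assumes fin: "finite I"
    and indep: "\<And>c. (\<Sum>i\<in>I. c i *\<^sub>C \<psi> i) = 0 \<Longrightarrow> \<forall>i\<in>I. c i = 0"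
    and herm: "\<And>i k. i \<in> I \<Longrightarrow> k \<in> I \<Longrightarrow> B k i = cnj (B i k)"
    and H: "\<And>f. H f = (\<Sum>i\<in>I. (\<Sum>k\<in>I. B i k * cinner f (\<psi> k)) *\<^sub>C \<psi> i)"
    and nz: "\<And>i. i \<in> I \<Longrightarrow> \<mu> i \<noteq> 0"
    and inj: "\<And>x. (\<forall>i\<in>I. (\<Sum>k\<in>I. D i k * x k) = 0) \<Longrightarrow> \<forall>k\<in>I. x k = 0"
    and form: "\<And>x. (\<Sum>i\<in>I. \<Sum>k\<in>I. B i k * x k * cnj (x i))
        = complex_of_real (\<Sum>i\<in>I. \<mu> i * (cmod (\<Sum>k\<in>I. D i k * x k))\<^sup>2)"
  shows "N_plus H = enat (card {i\<in>I. \<mu> i > 0})" "N_minus H = enat (card {i\<in>I. \<mu> i < 0})"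
proof -
  have lin: "clinear H"
    by (rule clinearI) (simp_all add: H cinner_add_left cinner_scaleC_left distrib_left
      sum.distrib L2.scale_left_distrib L2.scale_sum_right sum_distrib_left mult.left_commute)
  have sym: "cinner (H f) g = cinner f (H g)" for f g
  proof -
    have "cinner (H f) g = (\<Sum>i\<in>I. \<Sum>k\<in>I. B i k * cinner f (\<psi> k) * cinner (\<psi> i) g)"
      by (simp add: H cinner_sum_left cinner_scaleC_left sum_distrib_right)
    also have "\<dots> = (\<Sum>k\<in>I. \<Sum>i\<in>I. cnj (B k i * cinner g (\<psi> i)) * cinner f (\<psi> k))"
      by (subst sum.swap) (auto simp: herm[symmetric] cnj_cinner intro!: sum.cong)
    also have "\<dots> = cinner f (H g)"
      by (simp add: H cinner_sum_right cinner_scaleC_right sum_distrib_right)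
    finally show ?thesis .
  qed
  have ran: "range H \<subseteq> L2.span (\<psi> ` I)"
    by (auto simp: H intro!: L2.span_sum L2.span_scale intro: L2.span_base)
  obtain E \<kappa> where finE: "finite E" and on: "orthonormal E"
      and nzE: "\<And>e. e \<in> E \<Longrightarrow> \<kappa> e \<noteq> (0::real)"
      and HE: "\<And>f. H f = (\<Sum>e\<in>E. (complex_of_real (\<kappa> e) * cinner f e) *\<^sub>C e)"
    by (rule symmetric_diagonalization[OF lin sym finite_imageI[OF fin] ran]) (rule that; assumption)
  \<comment> \<open>The diagonalizing coordinates of \<open>B\<close>, read as functionals of
    \<open>f\<close>.\<close>
  define a where "a = (\<lambda>i f. \<Sum>k\<in>I. D i k * cinner f (\<psi> k))"
  have a_sum: "a i (\<Sum>n\<in>N. x n *\<^sub>C v n) = (\<Sum>n\<in>N. a i (v n) * x n)" for N :: "'n set" and x v i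
    unfolding a_def cinner_sum_left cinner_scaleC_left sum_distrib_left sum_distrib_right
    by (subst sum.swap) (simp add: mult_ac)
  have Q: "(\<Sum>i\<in>I. \<mu> i * (cmod (a i f))\<^sup>2) = (\<Sum>e\<in>E. \<kappa> e * (cmod (cinner f e))\<^sup>2)" for f
  proof -
    have "complex_of_real (\<Sum>i\<in>I. \<mu> i * (cmod (a i f))\<^sup>2)
        = (\<Sum>i\<in>I. \<Sum>k\<in>I. B i k * cinner f (\<psi> k) * cnj (cinner f (\<psi> i)))"
      unfolding a_def by (rule form[symmetric])
    also have "\<dots> = cinner (H f) f"
      by (simp add: H cinner_sum_left cinner_scaleC_left sum_distrib_right cnj_cinner)
    also have "\<dots> = (\<Sum>e\<in>E. complex_of_real (\<kappa> e) * (cinner f e * cnj (cinner f e)))"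
      by (simp add: HE cinner_sum_left cinner_scaleC_left cnj_cinner mult.assoc)
    also have "\<dots> = complex_of_real (\<Sum>e\<in>E. \<kappa> e * (cmod (cinner f e))\<^sup>2)"
      by (simp add: complex_norm_square del: of_real_power)
    finally show ?thesis by (simp only: of_real_eq_iff)
  qed
  \<comment> \<open>Invertibility of the Gram matrix: a combination \<open>f\<close> of the
    \<open>\<psi> k\<close> that is orthogonal to all of them is orthogonal to itself, and
    independence removes its coefficients.\<close>
  have inj1: "\<forall>k\<in>I. x k = 0" if "\<forall>i\<in>I. (\<Sum>k\<in>I. a i (\<psi> k) * x k) = 0" for x
  proof -
    define f where "f = (\<Sum>k\<in>I. x k *\<^sub>C \<psi> k)"
    have "\<forall>i\<in>I. a i f = 0" using that by (simp add: f_def a_sum)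
    then have "\<forall>k\<in>I. cinner f (\<psi> k) = 0" unfolding a_def by (rule inj)
    then have "cinner f f = 0"
      by (subst (2) f_def) (simp add: cinner_sum_right cinner_scaleC_right)
    then show ?thesis using indep[of x] by (simp add: f_def)
  qed
  have inj2: "\<forall>e\<in>E. x e = 0" if "\<forall>e\<in>E. (\<Sum>v\<in>E. cinner v e * x v) = 0" for x
  proof
    fix e assume e: "e \<in> E"
    have "x e = cinner (\<Sum>v\<in>E. x v *\<^sub>C v) e"
      by (rule cinner_orthonormal_sum[OF on finE e, symmetric])
    also have "\<dots> = (\<Sum>v\<in>E. cinner v e * x v)"
      by (simp add: cinner_sum_left cinner_scaleC_left mult.commute)
    finally show "x e = 0" using that e by simp
  qed
  \<comment> \<open>The factor \<open>s\<close> will be 1 and -1, so that negative weights are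
    counted by the same argument.\<close>
  have card: "card {i\<in>I. s * \<mu> i > 0} = card {e\<in>E. s * \<kappa> e > 0}" if s: "s \<noteq> 0" for s
  proof (rule antisym)
    show "card {i\<in>I. s * \<mu> i > 0} \<le> card {e\<in>E. s * \<kappa> e > 0}"
    proof (rule card_positive_weights_le[OF fin finE inj1])
      fix x
      have "(\<Sum>k\<in>I. cinner (\<psi> k) e * x k) = cinner (\<Sum>k\<in>I. x k *\<^sub>C \<psi> k) e" for e
        by (simp add: cinner_sum_left cinner_scaleC_left mult.commute)
      then show "(\<Sum>i\<in>I. s * \<mu> i * (cmod (\<Sum>k\<in>I. a i (\<psi> k) * x k))\<^sup>2)
          = (\<Sum>e\<in>E. s * \<kappa> e * (cmod (\<Sum>k\<in>I. cinner (\<psi> k) e * x k))\<^sup>2)"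
        using Q[of "\<Sum>k\<in>I. x k *\<^sub>C \<psi> k"]
        by (simp add: a_sum mult.assoc flip: sum_distrib_left)
    qed (use s nz in auto)
    show "card {e\<in>E. s * \<kappa> e > 0} \<le> card {i\<in>I. s * \<mu> i > 0}"
    proof (rule card_positive_weights_le[OF finE fin inj2])
      fix x
      have "(\<Sum>v\<in>E. cinner v e * x v) = cinner (\<Sum>v\<in>E. x v *\<^sub>C v) e" for e
        by (simp add: cinner_sum_left cinner_scaleC_left mult.commute)
      then show "(\<Sum>e\<in>E. s * \<kappa> e * (cmod (\<Sum>v\<in>E. cinner v e * x v))\<^sup>2)
          = (\<Sum>i\<in>I. s * \<mu> i * (cmod (\<Sum>v\<in>E. a i v * x v))\<^sup>2)"
        using Q[of "\<Sum>v\<in>E. x v *\<^sub>C v"]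
        by (simp add: a_sum mult.assoc flip: sum_distrib_left)
    qed (use s nzE in auto)
  qed
  show "N_plus H = enat (card {i\<in>I. \<mu> i > 0})"
    using card[of 1] spectral_count_diagonal[OF finE on nzE HE, of "{0<..}"]
    by (simp add: N_plus_def)
  show "N_minus H = enat (card {i\<in>I. \<mu> i < 0})"
    using card[of "-1"] spectral_count_diagonal[OF finE on nzE HE, of "{..<0}"]
    by (simp add: N_minus_def)
qed

text \<open>\<open>U\<close> spans an isotropic subspace that \<open>B\<close> pairs perfectly with \<open>L\<close>, so \<open>L \<union> U\<close> contributes
  \<open>card L\<close> hyperbolic planes.\<close>

lemma finite_rank_inertia_isotropic:
  fixes \<psi> :: "'i \<Rightarrow> L2" and B :: "'i \<Rightarrow> 'i \<Rightarrow> complex"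
  assumes fin: "finite L" "finite C" "finite U"
    and disj: "L \<inter> C = {}" "L \<inter> U = {}" "C \<inter> U = {}"
    and \<tau>: "bij_betw \<tau> U L"
    and I: "I = L \<union> C \<union> U"
    and indep: "\<And>c. (\<Sum>i\<in>I. c i *\<^sub>C \<psi> i) = 0 \<Longrightarrow> \<forall>i\<in>I. c i = 0"
    and herm: "\<And>i k. i \<in> I \<Longrightarrow> k \<in> I \<Longrightarrow> B k i = cnj (B i k)"
    and H: "\<And>f. H f = (\<Sum>i\<in>I. (\<Sum>k\<in>I. B i k * cinner f (\<psi> k)) *\<^sub>C \<psi> i)"
    and isotropic: "\<And>i k. i \<in> C \<union> U \<Longrightarrow> k \<in> C \<union> U \<Longrightarrow> i \<noteq> k \<or> i \<in> U \<Longrightarrow> B i k = 0"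
    and centre: "\<And>i. i \<in> C \<Longrightarrow> B i i \<noteq> 0"
    and pairing: "\<And>x. (\<forall>i\<in>L. (\<Sum>k\<in>U. B i k * x k) = 0) \<Longrightarrow> \<forall>k\<in>U. x k = 0"
  shows "N_plus H = enat (card L + card {i\<in>C. Re (B i i) > 0})"
    "N_minus H = enat (card L + card {i\<in>C. Re (B i i) < 0})"
proof -
  define \<delta> where "\<delta> = (\<lambda>i k :: 'i. if i = k then 1 else 0 :: complex)"
  \<comment> \<open>Rows in \<open>L\<close> carry the whole form except the diagonal on
    \<open>C\<close>: it is a sum of \<open>2 * Re (cnj (x i) * y i)\<close>, where
    \<open>y i\<close> is row \<open>i\<close> of \<open>Y\<close> applied to \<open>x\<close>. An
    entry with both indices in \<open>L\<close> is met from both of its rows, hence the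
    half.\<close>
  define Y where "Y = (\<lambda>i k. if k \<in> L then B i k / 2 else B i k)"
  \<comment> \<open>Polarization turns the product of \<open>x i\<close> and \<open>y i\<close> into
    the squares of \<open>x i + y i\<close> and \<open>x i - y i\<close> with weights
    \<open>1/2\<close> and \<open>- 1/2\<close>. The first is stored at \<open>i\<close> in
    \<open>L\<close>, the second at the partner of \<open>i\<close> in \<open>U\<close>, so that
    \<open>D\<close> stays square.\<close>
  define D where "D = (\<lambda>i k. if i \<in> C then \<delta> i k else if i \<in> L then \<delta> i k + Y i k
      else \<delta> (\<tau> i) k - Y (\<tau> i) k)"
  define \<mu> where "\<mu> = (\<lambda>i. if i \<in> C then Re (B i i) else if i \<in> L then 1/2 else - 1/2 :: real)"
  have finI: "finite I" using fin I by simp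
  have real_diag: "complex_of_real (Re (B i i)) = B i i" if "i \<in> I" for i
    using herm[OF that that] by (simp add: complex_eq_iff)
  have sum_\<delta>: "(\<Sum>k\<in>I. \<delta> i k * x k) = x i" if "i \<in> I" for i x
  proof -
    have "(\<Sum>k\<in>I. \<delta> i k * x k) = (\<Sum>k\<in>I. if k = i then x k else 0)"
      by (rule sum.cong) (auto simp: \<delta>_def)
    then show ?thesis using that finI by simp
  qed
  have \<tau>L: "\<tau> i \<in> L" if "i \<in> U" for i using \<tau> that by (auto simp: bij_betw_def)
  have sum_D: "(\<Sum>k\<in>I. D i k * x k) = (if i \<in> C then x i else if i \<in> L
      then x i + (\<Sum>k\<in>I. Y i k * x k) else x (\<tau> i) - (\<Sum>k\<in>I. Y (\<tau> i) k * x k))"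
    if "i \<in> I" for i x
    using that \<tau>L[of i] sum_\<delta>[of i x] sum_\<delta>[of "\<tau> i" x] I
    by (auto simp: D_def sum.distrib sum_subtractf distrib_right left_diff_distrib)
  have sum_I: "(\<Sum>i\<in>I. g i) = (\<Sum>i\<in>L. g i) + (\<Sum>i\<in>C. g i) + (\<Sum>i\<in>U. g i)"
    for g :: "'i \<Rightarrow> 'b::comm_monoid_add"
    unfolding I using fin disj by (subst sum.union_disjoint; auto)+
  have inj: "\<forall>k\<in>I. x k = 0" if x: "\<forall>i\<in>I. (\<Sum>k\<in>I. D i k * x k) = 0" for x
  proof -
    have C: "x i = 0" if "i \<in> C" for i using x sum_D[of i x] that by (auto simp: I)
    \<comment> \<open>The two squares built from \<open>i\<close> vanish together, the second one
      being read off at the partner \<open>u\<close>.\<close>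
    have *: "x i = 0 \<and> (\<Sum>k\<in>I. Y i k * x k) = 0" if "i \<in> L" for i
    proof -
      obtain u where u: "u \<in> U" "i = \<tau> u" using bij_betw_imp_surj_on[OF \<tau>] \<open>i \<in> L\<close> by blast
      have "i \<in> I" "i \<notin> C" "u \<in> I" "u \<notin> C" "u \<notin> L"
        using \<open>i \<in> L\<close> u disj by (auto simp: I)
      then have "x i + (\<Sum>k\<in>I. Y i k * x k) = 0"
        using x sum_D[of i x] \<open>i \<in> L\<close> by simp
      moreover have "x i - (\<Sum>k\<in>I. Y i k * x k) = 0"
        using x sum_D[of u x] \<open>u \<in> I\<close> \<open>u \<notin> C\<close> \<open>u \<notin> L\<close> u(2) by simp
      moreover have "a = 0 \<and> b = 0" if "a + b = 0" "a - b = 0" for a b :: complex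
        using that by (simp add: complex_eq_iff)
      ultimately show ?thesis by blast
    qed
    have "(\<Sum>k\<in>U. B i k * x k) = 0" if "i \<in> L" for i
    proof -
      have "(\<Sum>k\<in>I. Y i k * x k) = (\<Sum>k\<in>U. Y i k * x k)"
        using * C by (simp add: sum_I)
      also have "\<dots> = (\<Sum>k\<in>U. B i k * x k)"
        using disj by (intro sum.cong) (auto simp: Y_def)
      finally show ?thesis using * that by simp
    qed
    then have "\<forall>k\<in>U. x k = 0" by (intro pairing) auto
    then show ?thesis using * C I by auto
  qed
  have form: "(\<Sum>i\<in>I. \<Sum>k\<in>I. B i k * x k * cnj (x i))
        = complex_of_real (\<Sum>i\<in>I. \<mu> i * (cmod (\<Sum>k\<in>I. D i k * x k))\<^sup>2)" for x
  proof -
    define q where "q = (\<lambda>i k. B i k * x k * cnj (x i))"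
    \<comment> \<open>The weights share each conjugate pair \<open>q i k\<close>,
      \<open>q k i\<close> between its two rows. A row in \<open>L\<close> takes everything from a
      row outside \<open>L\<close>, so that the rows in \<open>C\<close> and \<open>U\<close> are
      left with entries governed by \<open>isotropic\<close>.\<close>
    define w where "w = (\<lambda>i k. if i \<in> L then (if k \<in> L then 1/2 else 1)
      else if k \<in> L then 0 else 1/2 :: real)"
    define y where "y = (\<lambda>i. \<Sum>k\<in>I. Y i k * x k)"
    have q_cnj: "q k i = cnj (q i k)" if "i \<in> I" "k \<in> I" for i k
      using herm[OF that] by (simp add: q_def mult_ac)
    have w_add: "w i k + w k i = 1" for i k
      by (simp add: w_def)
    have "(\<Sum>i\<in>I. \<Sum>k\<in>I. q i k)
        = (\<Sum>i\<in>I. \<Sum>k\<in>I. complex_of_real (w i k) * q i k)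
          + (\<Sum>i\<in>I. \<Sum>k\<in>I. complex_of_real (w k i) * q i k)"
      unfolding sum.distrib[symmetric] distrib_right[symmetric] of_real_add[symmetric] w_add by simp
    also have "(\<Sum>i\<in>I. \<Sum>k\<in>I. complex_of_real (w k i) * q i k)
        = (\<Sum>i\<in>I. \<Sum>k\<in>I. complex_of_real (w i k) * cnj (q i k))"
      by (subst sum.swap) (intro sum.cong refl arg_cong2[of _ _ _ _ "(*)"] q_cnj)
    also have "(\<Sum>i\<in>I. \<Sum>k\<in>I. complex_of_real (w i k) * q i k) + \<dots>
        = complex_of_real (\<Sum>i\<in>I. \<Sum>k\<in>I. w i k * (2 * Re (q i k)))"
      unfolding sum.distrib[symmetric] of_real_sum
      by (intro sum.cong refl) (simp add: complex_eq_iff)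
    also have "(\<Sum>i\<in>I. \<Sum>k\<in>I. w i k * (2 * Re (q i k)))
        = (\<Sum>i\<in>L. 2 * Re (cnj (x i) * y i)) + (\<Sum>i\<in>C. Re (B i i) * (cmod (x i))\<^sup>2)"
    proof -
      have "(\<Sum>k\<in>I. w i k * (2 * Re (q i k))) = 2 * Re (cnj (x i) * y i)" if "i \<in> L" for i
        unfolding y_def sum_distrib_left Re_sum using that
        by (intro sum.cong refl) (auto simp: w_def q_def Y_def field_simps)
      moreover have "(\<Sum>k\<in>I. w i k * (2 * Re (q i k))) = Re (B i i) * (cmod (x i))\<^sup>2"
        if "i \<in> C" for i
      proof -
        have "w i k * (2 * Re (q i k)) = (if k = i then Re (B i i) * (cmod (x i))\<^sup>2 else 0)"
          if "k \<in> I" for k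
        proof (cases "k = i")
          case True
          have "q i i = B i i * complex_of_real ((cmod (x i))\<^sup>2)"
            unfolding complex_norm_square q_def by (rule mult.assoc)
          then have "Re (q i i) = Re (B i i) * (cmod (x i))\<^sup>2" by simp
          then show ?thesis using True \<open>i \<in> C\<close> disj by (auto simp: w_def)
        next
          case False
          then show ?thesis
            using isotropic[of i k] \<open>i \<in> C\<close> \<open>k \<in> I\<close> disj by (auto simp: w_def q_def I)
        qed
        then have "(\<Sum>k\<in>I. w i k * (2 * Re (q i k)))
            = (\<Sum>k\<in>I. if k = i then Re (B i i) * (cmod (x i))\<^sup>2 else 0)"
          by (intro sum.cong) auto
        then show ?thesis using that finI by (simp add: I)
      qed
      moreover have "(\<Sum>k\<in>I. w i k * (2 * Re (q i k))) = 0" if "i \<in> U" for i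
      proof (rule sum.neutral, clarify)
        fix k assume "k \<in> I"
        then show "w i k * (2 * Re (q i k)) = 0"
          using isotropic[of i k] that disj by (auto simp: w_def q_def I)
      qed
      ultimately show ?thesis by (simp add: sum_I[of "\<lambda>i. \<Sum>k\<in>I. w i k * (2 * Re (q i k))"])
    qed
    also have "\<dots> = (\<Sum>i\<in>I. \<mu> i * (cmod (\<Sum>k\<in>I. D i k * x k))\<^sup>2)"
    proof -
      have polar: "2 * Re (cnj a * b) = 1/2 * (cmod (a + b))\<^sup>2 - 1/2 * (cmod (a - b))\<^sup>2" for a b
        unfolding cmod_power2 by (simp add: power2_eq_square algebra_simps)
      have "(\<Sum>i\<in>U. \<mu> i * (cmod (\<Sum>k\<in>I. D i k * x k))\<^sup>2)
          = (\<Sum>i\<in>U. - 1/2 * (cmod (x (\<tau> i) - y (\<tau> i)))\<^sup>2)"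
      proof (rule sum.cong[OF refl])
        fix i assume "i \<in> U"
        then have "i \<in> I" "i \<notin> C" "i \<notin> L" using disj by (auto simp: I)
        then show "\<mu> i * (cmod (\<Sum>k\<in>I. D i k * x k))\<^sup>2 = - 1/2 * (cmod (x (\<tau> i) - y (\<tau> i)))\<^sup>2"
          by (simp add: sum_D \<mu>_def y_def)
      qed
      also have "\<dots> = (\<Sum>i\<in>L. - 1/2 * (cmod (x i - y i))\<^sup>2)"
        by (rule sum.reindex_bij_betw[OF \<tau>])
      finally have U: "(\<Sum>i\<in>U. \<mu> i * (cmod (\<Sum>k\<in>I. D i k * x k))\<^sup>2)
          = (\<Sum>i\<in>L. - 1/2 * (cmod (x i - y i))\<^sup>2)" .
      have L: "(\<Sum>i\<in>L. \<mu> i * (cmod (\<Sum>k\<in>I. D i k * x k))\<^sup>2)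
          = (\<Sum>i\<in>L. 1/2 * (cmod (x i + y i))\<^sup>2)"
      proof (rule sum.cong[OF refl])
        fix i assume "i \<in> L"
        then have "i \<in> I" "i \<notin> C" "i \<in> L" using disj by (auto simp: I)
        then show "\<mu> i * (cmod (\<Sum>k\<in>I. D i k * x k))\<^sup>2 = 1/2 * (cmod (x i + y i))\<^sup>2"
          by (simp add: sum_D \<mu>_def y_def)
      qed
      have C: "(\<Sum>i\<in>C. \<mu> i * (cmod (\<Sum>k\<in>I. D i k * x k))\<^sup>2)
          = (\<Sum>i\<in>C. Re (B i i) * (cmod (x i))\<^sup>2)"
      proof (rule sum.cong[OF refl])
        fix i assume "i \<in> C"
        then have "i \<in> I" by (simp add: I)
        then show "\<mu> i * (cmod (\<Sum>k\<in>I. D i k * x k))\<^sup>2 = Re (B i i) * (cmod (x i))\<^sup>2"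
          using \<open>i \<in> C\<close> by (simp add: sum_D \<mu>_def)
      qed
      have "(\<Sum>i\<in>L. 2 * Re (cnj (x i) * y i))
          = (\<Sum>i\<in>L. 1/2 * (cmod (x i + y i))\<^sup>2) + (\<Sum>i\<in>L. - 1/2 * (cmod (x i - y i))\<^sup>2)"
        unfolding sum.distrib[symmetric] by (intro sum.cong refl) (subst polar, simp)
      then show ?thesis
        unfolding sum_I[of "\<lambda>i. \<mu> i * (cmod (\<Sum>k\<in>I. D i k * x k))\<^sup>2"] L C U by simp
    qed
    finally show ?thesis by (simp only: q_def)
  qed
  have nz: "\<mu> i \<noteq> 0" if "i \<in> I" for i
  proof (cases "i \<in> C")
    case True
    then have "complex_of_real (Re (B i i)) \<noteq> 0" using centre real_diag[of i] I by auto
    then show ?thesis using True by (simp add: \<mu>_def)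
  qed (auto simp: \<mu>_def)
  note * = finite_rank_inertia[OF finI indep herm H nz inj form]
  have "{i\<in>I. \<mu> i > 0} = L \<union> {i\<in>C. Re (B i i) > 0}"
    using disj by (auto simp: \<mu>_def I)
  moreover have "card (L \<union> {i\<in>C. Re (B i i) > 0}) = card L + card {i\<in>C. Re (B i i) > 0}"
    using disj fin by (intro card_Un_disjoint) auto
  ultimately show "N_plus H = enat (card L + card {i\<in>C. Re (B i i) > 0})"
    using *(1) by simp
  have "{i\<in>I. \<mu> i < 0} = U \<union> {i\<in>C. Re (B i i) < 0}"
    using disj by (auto simp: \<mu>_def I)
  moreover have "card (U \<union> {i\<in>C. Re (B i i) < 0}) = card U + card {i\<in>C. Re (B i i) < 0}"
    using disj fin by (intro card_Un_disjoint) auto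
  moreover have "card U = card L" using \<tau> by (rule bij_betw_same_card)
  ultimately show "N_minus H = enat (card L + card {i\<in>C. Re (B i i) < 0})"
    using *(2) by simp
qed

section \<open>Exponential monomials and the Hankel operator\<close>

lemma abs_L2_add: "square_integrable f \<Longrightarrow> square_integrable g \<Longrightarrow>
    abs_L2 f + abs_L2 g = abs_L2 (\<lambda>t. f t + g t)"
  by (rule plus_L2.abs_eq) auto

lemma abs_L2_scaleC: "square_integrable f \<Longrightarrow> c *\<^sub>C abs_L2 f = abs_L2 (\<lambda>t. c * f t)"
  by (rule scaleC.abs_eq) auto

lemma cinner_abs_L2: "square_integrable f \<Longrightarrow> square_integrable g \<Longrightarrow>
    cinner (abs_L2 f) (abs_L2 g) = (\<integral>t. f t * cnj (g t) \<partial>half_line)"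
  by (rule cinner.abs_eq) auto

lemma square_integrable_rep_L2: "square_integrable (rep_L2 f)"
  using Quotient_rep_reflp[OF Quotient_L2, of f] by simp

lemma abs_rep_L2: "abs_L2 (rep_L2 f) = f"
  by (rule Quotient_abs_rep[OF Quotient_L2])

lemma abs_L2_sum:
  assumes "\<And>i. i \<in> I \<Longrightarrow> square_integrable (g i)"
  shows "square_integrable (\<lambda>t. \<Sum>i\<in>I. c i * g i t)"
    and "(\<Sum>i\<in>I. c i *\<^sub>C abs_L2 (g i)) = abs_L2 (\<lambda>t. \<Sum>i\<in>I. c i * g i t)"
proof -
  have "square_integrable (\<lambda>t. \<Sum>i\<in>I. c i * g i t) \<and>
      (\<Sum>i\<in>I. c i *\<^sub>C abs_L2 (g i)) = abs_L2 (\<lambda>t. \<Sum>i\<in>I. c i * g i t)"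
    using assms
  proof (induction I rule: infinite_finite_induct)
    case (insert i I)
    then show ?case
      by (auto simp: abs_L2_scaleC abs_L2_add square_integrable_mult_left square_integrable_add)
  qed (auto simp: square_integrable_zero zero_L2_def)
  then show "square_integrable (\<lambda>t. \<Sum>i\<in>I. c i * g i t)"
    "(\<Sum>i\<in>I. c i *\<^sub>C abs_L2 (g i)) = abs_L2 (\<lambda>t. \<Sum>i\<in>I. c i * g i t)" by auto
qed

text \<open>The set where \<open>f\<close> is nonzero is open and negligible, hence empty. This
  leads from equality in the quotient to equality at every point.\<close>

lemma abs_L2_eq_0_continuous:
  assumes f: "square_integrable f" "abs_L2 f = 0" and cont: "continuous_on {0<..} f" and t: "t > 0"
  shows "f t = 0"
proof -
  have "AE t in half_line. f t = 0"
    using Quotient_rel[OF Quotient_L2, of f "\<lambda>t. 0"] f square_integrable_zero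
    by (simp add: zero_L2_def)
  then have ae: "AE t in lebesgue. t \<in> {0<..} \<longrightarrow> f t = 0"
    by (subst (asm) AE_restrict_space_iff) auto
  define S where "S = {t \<in> {0<..}. f t \<noteq> 0}"
  have "S = {0<..} \<inter> f -` (- {0})" by (auto simp: S_def)
  then have "open S"
    using continuous_open_preimage[OF cont open_greaterThan, of "- {0}"] by auto
  moreover have "negligible S"
  proof -
    have "S \<in> sets lebesgue" using \<open>open S\<close> by (auto intro: borel_open)
    moreover have "AE t in lebesgue. t \<notin> S" using ae by (auto simp: S_def)
    ultimately have "S \<in> null_sets lebesgue" by (simp add: AE_iff_null_sets)
    then show ?thesis by (simp add: negligible_iff_null_sets)
  qed
  ultimately have "S = {}" using open_not_negligible by blast
  then show ?thesis using t by (auto simp: S_def)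
qed

definition exp_monomial :: "complex \<Rightarrow> nat \<Rightarrow> real \<Rightarrow> complex" where
  "exp_monomial a j t = complex_of_real t ^ j * exp (- a * complex_of_real t)"

lemma continuous_on_exp_monomial: "continuous_on S (exp_monomial a j)"
  unfolding exp_monomial_def by (intro continuous_intros)

lemma cnj_exp_monomial: "cnj (exp_monomial a j t) = exp_monomial (cnj a) j t"
  by (simp add: exp_monomial_def exp_cnj)

text \<open>The squared modulus is \<open>t ^ (2 * j) * exp (- 2 * Re a * t)\<close>, up to scaling
  the integrand of the Gamma function at \<open>2 * j + 1\<close>.\<close>

lemma square_integrable_exp_monomial:
  assumes "Re a > 0"
  shows "square_integrable (exp_monomial a j)"
  unfolding square_integrable_def
proof
  show "exp_monomial a j \<in> borel_measurable half_line"
    by (rule continuous_imp_measurable_on_sets_lebesgue[OF continuous_on_exp_monomial]) simp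
  have "(\<lambda>t. complex_of_real t powr (of_nat (2 * j + 1) - 1) / of_real (exp (2 * Re a * t)))
      absolutely_integrable_on {0<..}"
    using assms by (intro absolutely_integrable_Gamma_integral) auto
  then have "integrable half_line
      (\<lambda>t. complex_of_real t powr (of_nat (2 * j + 1) - 1) / of_real (exp (2 * Re a * t)))"
    by (rule absolutely_integrable_imp_integrable) simp
  then have "integrable half_line
      (\<lambda>t. cmod (complex_of_real t powr (of_nat (2 * j + 1) - 1) / of_real (exp (2 * Re a * t))))"
    by (rule integrable_norm)
  moreover have "cmod (complex_of_real t powr (of_nat (2 * j + 1) - 1) / of_real (exp (2 * Re a * t)))
      = (cmod (exp_monomial a j t))\<^sup>2" if "t > 0" for t
  proof -
    have "complex_of_real t powr (of_nat (2 * j + 1) - 1) = complex_of_real t ^ (2 * j)"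
      using that by (simp add: powr_nat' flip: of_nat_mult)
    moreover have "(cmod (exp_monomial a j t))\<^sup>2 = t ^ (2 * j) * (exp (- Re a * t))\<^sup>2"
      using that by (simp add: exp_monomial_def norm_mult norm_power power_mult_distrib power_mult
          power2_eq_square mult_ac)
    moreover have "(exp (- Re a * t))\<^sup>2 = 1 / exp (2 * Re a * t)"
      by (simp add: power2_eq_square exp_minus inverse_eq_divide flip: exp_add)
    ultimately show ?thesis
      using that by (simp add: norm_divide norm_power)
  qed
  ultimately show "integrable half_line (\<lambda>t. (cmod (exp_monomial a j t))\<^sup>2)"
    by (subst (asm) Bochner_Integration.integrable_cong[OF refl, where g = "\<lambda>t. (cmod (exp_monomial a j t))\<^sup>2"]) auto
qed

lemma exp_monomial_independent:
  assumes fin: "finite A" and inj: "inj_on \<alpha> A" and Re: "\<And>m. m \<in> A \<Longrightarrow> Re (\<alpha> m) > 0"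
    and zero: "(\<Sum>(m, j)\<in>(SIGMA m:A. {..K m}). c (m, j) *\<^sub>C abs_L2 (exp_monomial (\<alpha> m) j)) = 0"
  shows "\<forall>i\<in>(SIGMA m:A. {..K m}). c i = 0"
proof -
  define I where "I = (SIGMA m:A. {..K m})"
  define g where "g = (\<lambda>i. exp_monomial (\<alpha> (fst i)) (snd i))"
  have g: "square_integrable (g i)" if "i \<in> I" for i
    using that Re by (auto simp: g_def I_def intro: square_integrable_exp_monomial)
  define f where "f = (\<lambda>t. \<Sum>i\<in>I. c i * g i t)"
  have sq: "square_integrable f"
    unfolding f_def by (rule abs_L2_sum(1)[OF g])
  have "abs_L2 f = (\<Sum>i\<in>I. c i *\<^sub>C abs_L2 (g i))"
    unfolding f_def by (rule abs_L2_sum(2)[OF g, symmetric])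
  also have "\<dots> = 0" using zero by (simp add: I_def g_def case_prod_unfold)
  finally have "abs_L2 f = 0" .
  moreover have "continuous_on {0<..} f"
    unfolding f_def g_def by (intro continuous_intros continuous_on_exp_monomial)
  ultimately have f0: "f t = 0" if "t > 0" for t
    using abs_L2_eq_0_continuous[OF sq] that by blast
  define Q where "Q = (\<lambda>m. \<Sum>j\<le>K m. monom (c (m, j)) j)"
  \<comment> \<open>\<open>exp_poly_independent\<close> indexes its terms by the exponents
    themselves; \<open>b\<close> recovers the index \<open>m\<close> from the exponent.\<close>
  define b where "b = the_inv_into A \<alpha>"
  have b: "b (\<alpha> m) = m" if "m \<in> A" for m
    unfolding b_def using inj that by (rule the_inv_into_f_f)
  have "\<forall>a\<in>(\<lambda>m. - \<alpha> m) ` A. Q (b (- a)) = 0"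
  proof (rule exp_poly_independent)
    fix t :: real assume t: "t > 0"
    have "(\<Sum>a\<in>(\<lambda>m. - \<alpha> m) ` A. poly (Q (b (- a))) (complex_of_real t) * exp (a * complex_of_real t))
        = (\<Sum>m\<in>A. poly (Q m) (complex_of_real t) * exp (- \<alpha> m * complex_of_real t))"
      using inj by (subst sum.reindex) (auto simp: inj_on_def b intro!: sum.cong)
    also have "\<dots> = (\<Sum>m\<in>A. \<Sum>j\<le>K m. c (m, j) * exp_monomial (\<alpha> m) j t)"
      by (simp add: Q_def poly_sum poly_monom exp_monomial_def sum_distrib_right mult.assoc)
    also have "\<dots> = f t"
      unfolding f_def g_def I_def using fin by (subst sum.Sigma) (auto simp: case_prod_unfold)
    finally show "(\<Sum>a\<in>(\<lambda>m. - \<alpha> m) ` A. poly (Q (b (- a))) (complex_of_real t)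
        * exp (a * complex_of_real t)) = 0" using f0[OF t] by simp
  qed (use fin in simp)
  then have Q: "Q m = 0" if "m \<in> A" for m using b that by auto
  show ?thesis
  proof
    fix i assume "i \<in> (SIGMA m:A. {..K m})"
    then obtain m j where i: "i = (m, j)" "m \<in> A" "j \<le> K m" by auto
    have "coeff (Q m) j = c (m, j)" using i(3) by (simp add: Q_def coeff_sum)
    then show "c i = 0" using Q[OF i(2)] i(1) by simp
  qed
qed

text \<open>The binomial theorem sums over a triangle; here the sum is extended to the full square
  so that \<open>j\<close> and \<open>k\<close> can serve as independent row and column indices. The
  added entries have \<open>j + k\<close> above the degree and vanish, which is where the
  antitriangular shape comes from.\<close>

lemma poly_add_eq:
  fixes p :: "'a::comm_semiring_1 poly"
  assumes "degree p \<le> n"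
  shows "poly p (x + y) = (\<Sum>j\<le>n. \<Sum>k\<le>n. coeff p (j + k) * of_nat ((j + k) choose k) * x ^ j * y ^ k)"
proof -
  have "poly p (x + y) = (\<Sum>i\<le>n. coeff p i * (x + y) ^ i)"
    unfolding poly_altdef using assms by (intro sum.mono_neutral_left) (auto simp: coeff_eq_0)
  \<comment> \<open>Writing \<open>i\<close> as \<open>k + (i - k)\<close> makes the summand a
    function of \<open>k\<close> and \<open>i - k\<close>, the form that the reindexing of the
    triangle expects.\<close>
  also have "\<dots> = (\<Sum>i\<le>n. \<Sum>k\<le>i. coeff p (k + (i - k)) * of_nat ((k + (i - k)) choose k) * x ^ (i - k) * y ^ k)"
    by (intro sum.cong refl)
       (simp add: add.commute[of x y] binomial_ring sum_distrib_left mult_ac)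
  also have "\<dots> = (\<Sum>(k, j)\<in>{(k, j). k + j \<le> n}. coeff p (k + j) * of_nat ((k + j) choose k) * x ^ j * y ^ k)"
    by (rule sum.triangle_reindex_eq[symmetric])
  also have "\<dots> = (\<Sum>(k, j)\<in>{..n} \<times> {..n}. coeff p (k + j) * of_nat ((k + j) choose k) * x ^ j * y ^ k)"
  proof (rule sum.mono_neutral_left)
    have "coeff p (k + j) = 0" if "\<not> k + j \<le> n" for k j
      using that assms by (simp add: coeff_eq_0)
    then have "coeff p (k + j) \<noteq> 0 \<Longrightarrow> k + j \<le> n" for k j by blast
    then show "\<forall>i\<in>{..n} \<times> {..n} - {(k, j). k + j \<le> n}.
        (case i of (k, j) \<Rightarrow> coeff p (k + j) * of_nat ((k + j) choose k) * x ^ j * y ^ k) = 0"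
      by (auto, metis mult_zero_left)
  qed auto
  also have "\<dots> = (\<Sum>j\<le>n. \<Sum>k\<le>n. coeff p (j + k) * of_nat ((j + k) choose k) * x ^ j * y ^ k)"
    by (subst sum.cartesian_product[symmetric], subst sum.swap) (simp add: add.commute)
  finally show ?thesis .
qed

text \<open>The exponential of \<open>t + s\<close> factors, and the factor in \<open>s\<close> is
  integrated against \<open>f\<close>. Since \<open>cinner\<close> conjugates its second argument,
  that integral is a product with a monomial of the conjugate exponent; hence row \<open>m\<close>
  of \<open>B\<close> meets only column \<open>\<sigma> m\<close>.\<close>

lemma hankel_op_exp_poly:
  assumes fin: "finite A" and Re: "\<And>m. m \<in> A \<Longrightarrow> Re (\<alpha> m) > 0"
    and deg: "\<And>m. m \<in> A \<Longrightarrow> degree (P m) = K m"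
    and \<sigma>: "\<And>m. m \<in> A \<Longrightarrow> \<sigma> m \<in> A \<and> \<alpha> (\<sigma> m) = cnj (\<alpha> m) \<and> K (\<sigma> m) = K m"
    and h: "h = (\<lambda>t. \<Sum>m\<in>A. poly (P m) (complex_of_real t) * exp (- \<alpha> m * complex_of_real t))"
    and B: "B = (\<lambda>(m, j) (m', k). if m' = \<sigma> m then coeff (P m) (j + k) * of_nat ((j + k) choose k) else 0)"
    and \<psi>: "\<psi> = (\<lambda>(m, j). abs_L2 (exp_monomial (\<alpha> m) j))"
    and I: "I = (SIGMA m:A. {..K m})"
  shows "hankel_op h f = (\<Sum>i\<in>I. (\<Sum>k\<in>I. B i k * cinner f (\<psi> k)) *\<^sub>C \<psi> i)"
proof -
  define g where "g = (\<lambda>i. exp_monomial (\<alpha> (fst i)) (snd i))"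
  have g: "square_integrable (g i)" if "i \<in> I" for i
    using that Re by (auto simp: g_def I intro: square_integrable_exp_monomial)
  have \<psi>_g: "\<psi> i = abs_L2 (g i)" for i by (simp add: \<psi> g_def case_prod_unfold)
  have int: "integrable half_line (\<lambda>s. cnj (g k s) * rep_L2 f s)" if "k \<in> I" for k
    using integrable_mult_cnj[OF square_integrable_rep_L2 g[OF that], of f] by (simp add: mult.commute)
  have cinner: "cinner f (\<psi> k) = (\<integral>s. cnj (g k s) * rep_L2 f s \<partial>half_line)" if "k \<in> I" for k
    using cinner_abs_L2[OF square_integrable_rep_L2 g[OF that], of f]
    by (simp add: \<psi>_g abs_rep_L2 mult.commute)
  have finI: "finite I" using fin by (simp add: I)
  have h_add: "h (t + s) = (\<Sum>i\<in>I. \<Sum>k\<in>I. B i k * g i t * cnj (g k s))" for t s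
  proof -
    have "h (t + s) = (\<Sum>m\<in>A. \<Sum>j\<le>K m. \<Sum>k\<le>K m. coeff (P m) (j + k) * of_nat ((j + k) choose k)
        * g (m, j) t * cnj (g (\<sigma> m, k) s))"
      unfolding h
    proof (rule sum.cong[OF refl])
      fix m assume m: "m \<in> A"
      have e: "exp (- \<alpha> m * (complex_of_real t + complex_of_real s))
          = exp (- \<alpha> m * complex_of_real t) * exp (- \<alpha> m * complex_of_real s)"
        by (simp flip: exp_add add: algebra_simps)
      have cnj_g: "cnj (g (\<sigma> m, k) s) = exp_monomial (\<alpha> m) k s" for k
        using \<sigma>[OF m] by (simp add: g_def cnj_exp_monomial)
      show "poly (P m) (complex_of_real (t + s)) * exp (- \<alpha> m * complex_of_real (t + s))
          = (\<Sum>j\<le>K m. \<Sum>k\<le>K m. coeff (P m) (j + k) * of_nat ((j + k) choose k)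
              * g (m, j) t * cnj (g (\<sigma> m, k) s))"
        unfolding of_real_add e cnj_g poly_add_eq[OF eq_refl[OF deg[OF m]]] sum_distrib_right
        by (intro sum.cong refl) (simp add: g_def exp_monomial_def)
    qed
    also have "\<dots> = (\<Sum>m\<in>A. \<Sum>j\<le>K m. \<Sum>k\<in>I. B (m, j) k * g (m, j) t * cnj (g k s))"
    proof (intro sum.cong refl)
      fix m j assume m: "m \<in> A"
      have "(\<Sum>k\<in>I. B (m, j) k * g (m, j) t * cnj (g k s))
          = (\<Sum>m'\<in>A. \<Sum>k\<le>K m'. B (m, j) (m', k) * g (m, j) t * cnj (g (m', k) s))"
        unfolding I using fin by (subst sum.Sigma) (auto simp: case_prod_unfold)
      also have "\<dots> = (\<Sum>m'\<in>A. if m' = \<sigma> m then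
          (\<Sum>k\<le>K m'. coeff (P m) (j + k) * of_nat ((j + k) choose k) * g (m, j) t * cnj (g (m', k) s)) else 0)"
        by (intro sum.cong refl) (auto simp: B)
      also have "\<dots> = (\<Sum>k\<le>K m. coeff (P m) (j + k) * of_nat ((j + k) choose k)
              * g (m, j) t * cnj (g (\<sigma> m, k) s))"
        using \<sigma>[OF m] fin by simp
      finally show "(\<Sum>k\<le>K m. coeff (P m) (j + k) * of_nat ((j + k) choose k)
              * g (m, j) t * cnj (g (\<sigma> m, k) s)) = (\<Sum>k\<in>I. B (m, j) k * g (m, j) t * cnj (g k s))" ..
    qed
    also have "\<dots> = (\<Sum>i\<in>I. \<Sum>k\<in>I. B i k * g i t * cnj (g k s))"
      unfolding I using fin by (subst sum.Sigma) (auto simp: case_prod_unfold)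
    finally show ?thesis .
  qed
  have "(\<integral>s. h (t + s) * rep_L2 f s \<partial>half_line) = (\<Sum>i\<in>I. (\<Sum>k\<in>I. B i k * cinner f (\<psi> k)) * g i t)" for t
  proof -
    have "(\<integral>s. h (t + s) * rep_L2 f s \<partial>half_line)
        = (\<integral>s. (\<Sum>i\<in>I. \<Sum>k\<in>I. (B i k * g i t) * (cnj (g k s) * rep_L2 f s)) \<partial>half_line)"
      by (simp add: h_add sum_distrib_right mult.assoc)
    also have "\<dots> = (\<Sum>i\<in>I. \<Sum>k\<in>I. (B i k * g i t) * (\<integral>s. cnj (g k s) * rep_L2 f s \<partial>half_line))"
      using int by simp
    also have "\<dots> = (\<Sum>i\<in>I. (\<Sum>k\<in>I. B i k * cinner f (\<psi> k)) * g i t)"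
      unfolding sum_distrib_right by (intro sum.cong refl) (simp add: cinner mult_ac)
    finally show ?thesis .
  qed
  then have "hankel_op h f = abs_L2 (\<lambda>t. \<Sum>i\<in>I. (\<Sum>k\<in>I. B i k * cinner f (\<psi> k)) * g i t)"
    unfolding hankel_op_def by simp
  also have "\<dots> = (\<Sum>i\<in>I. (\<Sum>k\<in>I. B i k * cinner f (\<psi> k)) *\<^sub>C abs_L2 (g i))"
    by (rule abs_L2_sum(2)[OF g, symmetric])
  finally show ?thesis by (simp add: \<psi>_g)
qed

text \<open>On real arguments conjugating the value amounts to conjugating the coefficients, and the
  real line has enough points to determine a polynomial.\<close>

lemma cnj_coeff_of_cnj_poly:
  assumes "\<And>t. poly q (complex_of_real t) = cnj (poly p (complex_of_real t))"
  shows "coeff q n = cnj (coeff p n)"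
proof -
  have "poly (q - map_poly cnj p) (complex_of_real t) = 0" for t
    by (simp add: assms)
  then have "range complex_of_real \<subseteq> {z. poly (q - map_poly cnj p) z = 0}" by auto
  moreover have "infinite (range complex_of_real)"
    using finite_imageD[of complex_of_real UNIV] infinite_UNIV_char_0 by (auto simp: inj_on_def)
  ultimately have "q - map_poly cnj p = 0"
    using poly_roots_finite finite_subset by blast
  then have "q = map_poly cnj p" by simp
  then show ?thesis by (simp add: coeff_map_poly)
qed

lemma poly_higher_pderiv_0:
  fixes p :: "'a::{comm_semiring_1,semiring_no_zero_divisors,semiring_char_0} poly"
  shows "poly ((pderiv ^^ n) p) 0 = fact n * coeff p n"
proof (induction n arbitrary: p)
  case (Suc n)
  have "poly ((pderiv ^^ Suc n) p) 0 = poly ((pderiv ^^ n) (pderiv p)) 0"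
    by (simp add: funpow_swap1)
  then show ?case using Suc[of "pderiv p"] by (simp add: coeff_pderiv mult_ac)
qed (simp add: poly_0_coeff_0)

section \<open>Counting the eigenvalues of the Hankel operator\<close>

text \<open>Substitution in order of increasing second index: row \<open>\<tau> u\<close> involves
  only \<open>x u\<close> and unknowns already known to vanish.\<close>

lemma antitriangular_pairing:
  fixes B :: "'m \<times> nat \<Rightarrow> 'm \<times> nat \<Rightarrow> complex"
  assumes fin: "finite U"
    and \<tau>: "\<And>u. u \<in> U \<Longrightarrow> \<tau> u \<in> L \<and> B (\<tau> u) u \<noteq> 0"
    and zero: "\<And>u v. u \<in> U \<Longrightarrow> v \<in> U \<Longrightarrow> B (\<tau> u) v \<noteq> 0 \<Longrightarrow> v \<noteq> u \<Longrightarrow> snd v < snd u"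
    and x: "\<forall>i\<in>L. (\<Sum>k\<in>U. B i k * x k) = 0"
  shows "\<forall>k\<in>U. x k = 0"
proof -
  have "x u = 0" if "u \<in> U" for u
    using that
  proof (induction "snd u" arbitrary: u rule: less_induct)
    case less
    have "B (\<tau> u) v * x v = (if v = u then B (\<tau> u) u * x u else 0)" if "v \<in> U" for v
      using less.hyps[of v] zero[OF less.prems that] that by (cases "B (\<tau> u) v = 0") auto
    then have "(\<Sum>k\<in>U. B (\<tau> u) k * x k) = (\<Sum>k\<in>U. if k = u then B (\<tau> u) u * x u else 0)"
      by (intro sum.cong) auto
    then have "B (\<tau> u) u * x u = 0"
      using x \<tau>[OF less.prems] fin less.prems by simp
    then show ?case using \<tau>[OF less.prems] by simp
  qed
  then show ?thesis by blast
qed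

lemma card_lower_half: "card {j::nat. 2 * j < K} = (K + 1) div 2"
proof -
  have "{j::nat. 2 * j < K} = {..<(K + 1) div 2}" by auto
  then show ?thesis by simp
qed

text \<open>Here conjugation of exponents is an abstract involution \<sigma> on the indices, with
  fixed points \<open>R\<close> and with \<open>T\<close> holding one member of each conjugate pair.
  This keeps the index shifts of the numbered version out of the argument.\<close>

lemma hankel_inertia:
  fixes \<alpha> :: "'m \<Rightarrow> complex"
  assumes fin: "finite R" "finite T"
    and disj: "R \<inter> T = {}" "R \<inter> \<sigma> ` T = {}" "T \<inter> \<sigma> ` T = {}"
    and A: "A = R \<union> T \<union> \<sigma> ` T"
    and \<sigma>_R: "\<And>m. m \<in> R \<Longrightarrow> \<sigma> m = m" and \<sigma>_T: "\<And>m. m \<in> T \<Longrightarrow> \<sigma> (\<sigma> m) = m"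
    and inj: "inj_on \<alpha> A" and Re: "\<And>m. m \<in> A \<Longrightarrow> Re (\<alpha> m) > 0"
    and deg: "\<And>m. m \<in> A \<Longrightarrow> P m \<noteq> 0 \<and> degree (P m) = K m"
    and cnj_\<alpha>: "\<And>m. m \<in> A \<Longrightarrow> \<alpha> (\<sigma> m) = cnj (\<alpha> m)"
    and cnj_P: "\<And>m n. m \<in> A \<Longrightarrow> coeff (P (\<sigma> m)) n = cnj (coeff (P m) n)"
    and h: "h = (\<lambda>t. \<Sum>m\<in>A. poly (P m) (complex_of_real t) * exp (- \<alpha> m * complex_of_real t))"
  shows "N_plus (hankel_op h)
      = enat ((\<Sum>m\<in>R. local_plus (K m) (top_deriv (P m))) + (\<Sum>m\<in>T. K m) + card T)"
    and "N_minus (hankel_op h)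
      = enat ((\<Sum>m\<in>R. local_minus (K m) (top_deriv (P m))) + (\<Sum>m\<in>T. K m) + card T)"
proof -
  have \<sigma>A: "\<sigma> m \<in> A" and \<sigma>\<sigma>: "\<sigma> (\<sigma> m) = m" if "m \<in> A" for m
    using that \<sigma>_R \<sigma>_T by (auto simp: A)
  have K\<sigma>: "K (\<sigma> m) = K m" if "m \<in> A" for m
  proof -
    have "P (\<sigma> m) = map_poly cnj (P m)"
      by (rule poly_eqI) (simp add: cnj_P that coeff_map_poly)
    then have "degree (P (\<sigma> m)) = degree (P m)" by (simp add: degree_map_poly)
    then show ?thesis using deg[OF that] deg[OF \<sigma>A[OF that]] by simp
  qed
  have lead: "coeff (P m) (K m) \<noteq> 0" if "m \<in> A" for m
    using deg[OF that] by (metis leading_coeff_neq_0)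
  have high: "coeff (P m) n = 0" if "m \<in> A" "n > K m" for m n
    using deg[OF that(1)] that(2) by (auto intro: coeff_eq_0)
  \<comment> \<open>\<open>U\<close> is isotropic for two reasons. For a real exponent, two indices
    above the middle add up to more than the degree. Indices over the image of \<open>T\<close>
    under \<sigma> couple only to indices over \<open>T\<close>, and all of these lie in
    \<open>L\<close>.\<close>
  define L where "L = (SIGMA m:R. {j. 2 * j < K m}) \<union> (SIGMA m:T. {..K m})"
  define C where "C = (SIGMA m:R. {j. 2 * j = K m})"
  define U where "U = (SIGMA m:R. {j. j \<le> K m \<and> K m < 2 * j}) \<union> (SIGMA m:\<sigma> ` T. {..K m})"
  define I where "I = (SIGMA m:A. {..K m})"
  define B where "B = (\<lambda>(m, j) (m', k).
    if m' = \<sigma> m then coeff (P m) (j + k) * of_nat ((j + k) choose k) else 0)"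
  define \<psi> where "\<psi> = (\<lambda>(m, j). abs_L2 (exp_monomial (\<alpha> m) j))"
  \<comment> \<open>The reflection that leads to the antidiagonal: in row \<open>\<tau> u\<close>
    the entry in column \<open>u\<close> contains the leading coefficient.\<close>
  define \<tau> where "\<tau> = (\<lambda>(m, j). (\<sigma> m, K m - j))"
  have fin_half: "finite {j. 2 * j < K m}" "finite {j. 2 * j = K m}" for m
    by (rule finite_subset[of _ "{..K m}"]; auto)+
  have finL: "finite L" and finC: "finite C" and finU: "finite U"
    using fin fin_half by (auto simp: L_def C_def U_def)
  have I: "I = L \<union> C \<union> U"
    unfolding I_def L_def C_def U_def A by (auto simp: K\<sigma> A)
  have disjI: "L \<inter> C = {}" "L \<inter> U = {}" "C \<inter> U = {}"
    using disj by (auto simp: L_def C_def U_def)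
  have AI: "fst i \<in> A" "snd i \<le> K (fst i)" if "i \<in> I" for i
    using that by (auto simp: I_def)
  have LI: "i \<in> I" if "i \<in> L" for i using that I by blast
  have CI: "i \<in> I" if "i \<in> C" for i using that I by blast
  have UI: "i \<in> I" if "i \<in> U" for i using that I by blast
  have \<tau>U: "\<tau> u \<in> L" if "u \<in> U" for u
  proof -
    obtain m j where u: "u = (m, j)" by (cases u)
    consider "m \<in> R" "j \<le> K m" "K m < 2 * j" | m' where "m' \<in> T" "m = \<sigma> m'"
      using \<open>u \<in> U\<close> u by (auto simp: U_def)
    then show ?thesis
    proof cases
      case 1
      then have "(\<sigma> m, K m - j) \<in> (SIGMA m:R. {j. 2 * j < K m})" by (simp add: \<sigma>_R)
      then show ?thesis by (simp add: u \<tau>_def L_def)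
    next
      case 2
      then show ?thesis by (simp add: u \<tau>_def L_def \<sigma>_T K\<sigma> A)
    qed
  qed
  have \<tau>_bij: "bij_betw \<tau> U L"
  proof (rule bij_betw_byWitness[where f' = \<tau>])
    show "\<forall>u\<in>U. \<tau> (\<tau> u) = u"
    proof
      fix u assume "u \<in> U"
      then have "fst u \<in> A" "snd u \<le> K (fst u)" using AI UI by blast+
      then show "\<tau> (\<tau> u) = u" by (simp add: \<tau>_def case_prod_unfold K\<sigma> \<sigma>\<sigma>)
    qed
    show "\<forall>u\<in>L. \<tau> (\<tau> u) = u"
    proof
      fix u assume "u \<in> L"
      then have "fst u \<in> A" "snd u \<le> K (fst u)" using AI LI by blast+
      then show "\<tau> (\<tau> u) = u" by (simp add: \<tau>_def case_prod_unfold K\<sigma> \<sigma>\<sigma>)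
    qed
    show "\<tau> ` U \<subseteq> L" using \<tau>U by blast
    show "\<tau> ` L \<subseteq> U"
    proof (rule image_subsetI)
      fix u assume "u \<in> L"
      then show "\<tau> u \<in> U"
        unfolding L_def by (auto simp: \<tau>_def U_def \<sigma>_R K\<sigma> A)
    qed
  qed
  have indep: "\<forall>i\<in>I. c i = 0" if "(\<Sum>i\<in>I. c i *\<^sub>C \<psi> i) = 0" for c
    unfolding I_def
  proof (rule exp_monomial_independent[OF _ inj Re])
    show "finite A" using fin by (simp add: A)
    show "(\<Sum>(m, j)\<in>(SIGMA m:A. {..K m}). c (m, j) *\<^sub>C abs_L2 (exp_monomial (\<alpha> m) j)) = 0"
      using that by (simp add: I_def \<psi>_def case_prod_unfold)
  qed
  have herm: "B k i = cnj (B i k)" if ik: "i \<in> I" "k \<in> I" for i k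
  proof -
    obtain m j m' l where i: "i = (m, j)" and k: "k = (m', l)" by (cases i, cases k)
    have "m \<in> A" "m' \<in> A" using AI(1)[OF ik(1)] AI(1)[OF ik(2)] i k by auto
    have "(m = \<sigma> m') = (m' = \<sigma> m)" using \<sigma>\<sigma> \<open>m \<in> A\<close> \<open>m' \<in> A\<close> by metis
    moreover have "(l + j choose j) = (j + l choose l)"
      by (subst binomial_symmetric) (auto simp: add.commute)
    ultimately show ?thesis
      using \<open>m \<in> A\<close> by (auto simp: B_def i k cnj_P add.commute)
  qed
  have H: "hankel_op h f = (\<Sum>i\<in>I. (\<Sum>k\<in>I. B i k * cinner f (\<psi> k)) *\<^sub>C \<psi> i)" for f
    by (rule hankel_op_exp_poly[OF _ Re _ _ h B_def \<psi>_def I_def])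
       (use fin deg \<sigma>A cnj_\<alpha> K\<sigma> in \<open>auto simp: A\<close>)
  have isotropic: "B i k = 0" if i: "i \<in> C \<union> U" and k: "k \<in> C \<union> U" and ne: "i \<noteq> k \<or> i \<in> U" for i k
  proof (rule ccontr)
    assume nz: "B i k \<noteq> 0"
    obtain m j m' l where i': "i = (m, j)" and k': "k = (m', l)" by (cases i, cases k)
    have mA: "m \<in> A" using i CI UI AI(1)[of i] i' by auto
    have m': "m' = \<sigma> m" and jl: "j + l \<le> K m"
      using nz high[OF mA, of "j + l"] by (auto simp: B_def i' k' not_le[symmetric] split: if_splits)
    show False
    proof (cases "m \<in> R")
      case True
      then have "m' = m" using m' \<sigma>_R by simp
      then have "2 * j \<ge> K m" "2 * l \<ge> K m" "i \<in> U \<Longrightarrow> 2 * j > K m"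
        using i k disj True by (auto simp: C_def U_def i' k')
      then show False using jl ne i' k' \<open>m' = m\<close> by auto
    next
      case False
      then obtain n where "n \<in> T" "m = \<sigma> n" using i by (auto simp: C_def U_def i')
      then have "m' \<in> T" using m' \<sigma>_T by simp
      then show False using k disj by (auto simp: C_def U_def k')
    qed
  qed
  have centre_eq: "B i i = coeff (P m) (K m) * of_nat (K m choose j)"
    if "i = (m, j)" "i \<in> C" for i m j
    using that \<sigma>_R by (auto simp: B_def C_def mult_2)
  have centre: "B i i \<noteq> 0" if "i \<in> C" for i
  proof -
    obtain m j where i: "i = (m, j)" by (cases i)
    then have "m \<in> A" "2 * j = K m" using that by (auto simp: C_def A)
    then show ?thesis using centre_eq[OF i that] lead[of m] by (simp add: binomial_eq_0_iff)
  qed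
  have pairing: "\<forall>k\<in>U. x k = 0" if "\<forall>i\<in>L. (\<Sum>k\<in>U. B i k * x k) = 0" for x
  proof (rule antitriangular_pairing[OF finU _ _ that, where \<tau> = \<tau>])
    fix u assume u: "u \<in> U"
    obtain m j where u': "u = (m, j)" by (cases u)
    have mA: "m \<in> A" and j: "j \<le> K m" using AI[OF UI[OF u]] by (auto simp: u')
    have "B (\<tau> u) u \<noteq> 0"
      using lead[OF \<sigma>A[OF mA]] j by (simp add: B_def \<tau>_def u' \<sigma>\<sigma> mA K\<sigma> binomial_eq_0_iff)
    then show "\<tau> u \<in> L \<and> B (\<tau> u) u \<noteq> 0" using \<tau>U[OF u] by simp
    fix v assume v: "v \<in> U" "B (\<tau> u) v \<noteq> 0" "v \<noteq> u"
    obtain m' l where v': "v = (m', l)" by (cases v)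
    have "m' = m" using v by (auto simp: B_def \<tau>_def u' v' \<sigma>\<sigma> mA split: if_splits)
    \<comment> \<open>A column with \<open>l > j\<close> would call for a coefficient above the
      degree, so next to \<open>u\<close> only columns with smaller second index survive.\<close>
    moreover have "K m - j + l \<le> K m"
      using v high[OF \<sigma>A[OF mA], of "K m - j + l"]
      by (auto simp: B_def \<tau>_def u' v' K\<sigma> mA not_le[symmetric] split: if_splits)
    ultimately show "snd v < snd u" using v(3) j by (auto simp: u' v')
  qed
  note * = finite_rank_inertia_isotropic[OF finL finC finU disjI \<tau>_bij I indep herm H
      isotropic centre pairing]
  \<comment> \<open>Each exponent in \<open>T\<close> brings all of its \<open>K m + 1\<close>
    indices; the extra 1 is the origin of the summand \<open>card T\<close>.\<close>
  have cardL: "card L = (\<Sum>m\<in>R. (K m + 1) div 2) + (\<Sum>m\<in>T. K m) + card T"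
  proof -
    have "card L = card (SIGMA m:R. {j. 2 * j < K m}) + card (SIGMA m:T. {..K m})"
      unfolding L_def using fin fin_half disj by (intro card_Un_disjoint) auto
    also have "card (SIGMA m:R. {j. 2 * j < K m}) = (\<Sum>m\<in>R. (K m + 1) div 2)"
      using fin fin_half by (subst card_SigmaI) (auto simp: card_lower_half)
    also have "card (SIGMA m:T. {..K m}) = (\<Sum>m\<in>T. K m) + card T"
      using fin by (subst card_SigmaI) (auto simp: sum.distrib[of K "\<lambda>_. 1", simplified])
    finally show ?thesis by simp
  qed
  have top: "top_deriv (P m) = fact (K m) * Re (coeff (P m) (K m))" if "m \<in> A" for m
    using deg[OF that] by (simp add: top_deriv_def poly_higher_pderiv_0)
  \<comment> \<open>\<open>Q\<close> stands for either sign. The middle entry has real part a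
    binomial coefficient times that of the leading coefficient, and \<open>top_deriv\<close> is a
    factorial times the latter, so a predicate invariant under positive scaling treats them
    alike.\<close>
  have card_C: "card {i\<in>C. Q (Re (B i i))}
      = (\<Sum>m\<in>R. if even (K m) \<and> Q (top_deriv (P m)) then 1 else 0)"
    if Q: "\<And>c x. c > 0 \<Longrightarrow> Q (c * x) = Q (x::real)" for Q
  proof -
    have sign: "Q (Re (B (m, j) (m, j))) = Q (top_deriv (P m))" if "(m, j) \<in> C" for m j
    proof -
      have mA: "m \<in> A" and j: "2 * j = K m" using that by (auto simp: C_def A)
      have "Re (B (m, j) (m, j)) = real (K m choose j) * Re (coeff (P m) (K m))"
        unfolding centre_eq[OF refl that] by simp
      moreover have "real (K m choose j) > 0" using j by (simp add: zero_less_binomial)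
      ultimately show ?thesis using Q by (simp add: top[OF mA])
    qed
    have "{i\<in>C. Q (Re (B i i))} = (\<lambda>m. (m, K m div 2)) ` {m\<in>R. even (K m) \<and> Q (top_deriv (P m))}"
      (is "?X = ?Y")
    proof (intro equalityI subsetI)
      fix i assume "i \<in> ?X"
      moreover obtain m j where i: "i = (m, j)" by (cases i)
      ultimately have "m \<in> R" "2 * j = K m" "Q (top_deriv (P m))"
        using sign[of m j] by (auto simp: C_def)
      moreover from this have "even (K m)" "j = K m div 2" by (metis dvd_triv_left, simp flip: \<open>2 * j = K m\<close>)
      ultimately show "i \<in> ?Y" using i by auto
    next
      fix i assume "i \<in> ?Y"
      then obtain m where m: "i = (m, K m div 2)" "m \<in> R" "even (K m)" "Q (top_deriv (P m))" by auto
      then have "i \<in> C" by (auto simp: C_def)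
      then show "i \<in> ?X" using m sign[of m "K m div 2"] by simp
    qed
    then have "card {i\<in>C. Q (Re (B i i))} = card {m\<in>R. even (K m) \<and> Q (top_deriv (P m))}"
      by (simp add: card_image inj_on_def)
    also have "\<dots> = (\<Sum>m\<in>R. if even (K m) \<and> Q (top_deriv (P m)) then 1 else 0)"
      using fin by (simp add: sum.If_cases Int_def)
    finally show ?thesis .
  qed
  \<comment> \<open>For even \<open>K m\<close> the lower half has \<open>K m div 2\<close> indices
    and the middle one adds 1 if its sign fits; for odd \<open>K m\<close> there is no middle
    index.\<close>
  have local: "(\<Sum>m\<in>R. (K m + 1) div 2) + (\<Sum>m\<in>R. if even (K m) \<and> Q m then 1 else 0)
      = (\<Sum>m\<in>R. if odd (K m) then (K m + 1) div 2 else if Q m then K m div 2 + 1 else K m div 2)" for Q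
    unfolding sum.distrib[symmetric] by (intro sum.cong refl) auto
  have "card L + card {i\<in>C. Re (B i i) > 0}
      = (\<Sum>m\<in>R. local_plus (K m) (top_deriv (P m))) + (\<Sum>m\<in>T. K m) + card T"
    using cardL card_C[of "\<lambda>x. x > 0"] local[of "\<lambda>m. top_deriv (P m) > 0"]
    by (simp add: local_plus_def zero_less_mult_iff)
  then show "N_plus (hankel_op h)
      = enat ((\<Sum>m\<in>R. local_plus (K m) (top_deriv (P m))) + (\<Sum>m\<in>T. K m) + card T)"
    using *(1) by simp
  have "card L + card {i\<in>C. Re (B i i) < 0}
      = (\<Sum>m\<in>R. local_minus (K m) (top_deriv (P m))) + (\<Sum>m\<in>T. K m) + card T"
    using cardL card_C[of "\<lambda>x. x < 0"] local[of "\<lambda>m. top_deriv (P m) < 0"]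
    by (simp add: local_minus_def mult_less_0_iff)
  then show "N_minus (hankel_op h)
      = enat ((\<Sum>m\<in>R. local_minus (K m) (top_deriv (P m))) + (\<Sum>m\<in>T. K m) + card T)"
    using *(2) by simp
qed

theorem theorem1p1:
  fixes M0 M1 M :: nat
    and \<alpha> :: "nat \<Rightarrow> complex"
    and P :: "nat \<Rightarrow> complex poly"
    and K :: "nat \<Rightarrow> nat"
    and h :: "real \<Rightarrow> complex"
    and H :: "L2 \<Rightarrow> L2"
  assumes M: "M = M0 + 2 * M1"
    and distinct: "inj_on \<alpha> {1..M}"
    and Re_pos: "\<And>m. m \<in> {1..M} \<Longrightarrow> Re (\<alpha> m) > 0"
    and degree: "\<And>m. m \<in> {1..M} \<Longrightarrow> P m \<noteq> 0 \<and> degree (P m) = K m"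
    and real_exponent: "\<And>m. m \<in> {1..M0} \<Longrightarrow> Im (\<alpha> m) = 0"
    and real_poly: "\<And>m t. m \<in> {1..M0} \<Longrightarrow>
          poly (P m) (complex_of_real t) = cnj (poly (P m) (complex_of_real t))"
    and Im_pos: "\<And>m. m \<in> {M0 + 1..M0 + M1} \<Longrightarrow> Im (\<alpha> m) > 0"
    and conj_exponent: "\<And>m. m \<in> {M0 + 1..M0 + M1} \<Longrightarrow> \<alpha> (M1 + m) = cnj (\<alpha> m)"
    and conj_poly: "\<And>m t. m \<in> {M0 + 1..M0 + M1} \<Longrightarrow>
          poly (P (M1 + m)) (complex_of_real t) = cnj (poly (P m) (complex_of_real t))"
    and h: "h = exp_poly_kernel M \<alpha> P"
    and H: "H = hankel_op h"
  shows "N_plus H =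
           enat ((\<Sum>m=1..M0. local_plus (K m) (top_deriv (P m)))
               + (\<Sum>m=M0+1..M0+M1. K m) + M1) \<and>
         N_minus H =
           enat ((\<Sum>m=1..M0. local_minus (K m) (top_deriv (P m)))
               + (\<Sum>m=M0+1..M0+M1. K m) + M1)"
proof -
  \<comment> \<open>Conjugation of exponents as a permutation of \<open>{1..M}\<close>: the first
    \<open>M0\<close> indices are fixed and the two following blocks of length \<open>M1\<close> are
    exchanged, the last branch being the inverse of the middle one.\<close>
  define \<sigma> where "\<sigma> m = (if m \<le> M0 then m else if m \<le> M0 + M1 then M1 + m else m - M1)" for m
  define T where "T = {M0 + 1..M0 + M1}"
  have image: "\<sigma> ` T = {M0 + M1 + 1..M}"
  proof -
    have "\<sigma> ` T = (\<lambda>m. m + M1) ` T" by (rule image_cong) (auto simp: \<sigma>_def T_def)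
    then show ?thesis by (simp add: T_def M)
  qed
  have A: "{1..M} = {1..M0} \<union> T \<union> \<sigma> ` T"
    unfolding image by (auto simp: T_def M)
  have \<sigma>: "\<sigma> m = m" if "m \<in> {1..M0}" for m using that by (simp add: \<sigma>_def)
  have \<sigma>_T: "\<sigma> m = M1 + m" "\<sigma> (M1 + m) = m" if "m \<in> T" for m
    using that by (auto simp: \<sigma>_def T_def)
  have "\<alpha> (\<sigma> m) = cnj (\<alpha> m) \<and> (\<forall>n. coeff (P (\<sigma> m)) n = cnj (coeff (P m) n))"
    if "m \<in> {1..M}" for m
  proof -
    consider "m \<in> {1..M0}" | "m \<in> T" | m' where "m' \<in> T" "m = M1 + m'"
      using \<open>m \<in> {1..M}\<close> unfolding A using \<sigma>_T(1) by fastforce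
    then show ?thesis
    proof cases
      case 1
      then show ?thesis
        using \<sigma>[OF 1] real_exponent[OF 1] cnj_coeff_of_cnj_poly[OF real_poly[OF 1]]
        by (simp add: complex_eq_iff)
    next
      case 2
      then show ?thesis
        using \<sigma>_T(1)[OF 2] conj_exponent[of m] cnj_coeff_of_cnj_poly[OF conj_poly, of m]
        by (simp add: T_def)
    next
      case 3
      then show ?thesis
        using \<sigma>_T(2)[OF 3(1)] conj_exponent[of m'] cnj_coeff_of_cnj_poly[OF conj_poly, of m']
        by (simp add: T_def)
    qed
  qed
  note cnj = conjunct1[OF this] spec[OF conjunct2[OF this]]
  have h': "h = (\<lambda>t. \<Sum>m\<in>{1..M}. poly (P m) (complex_of_real t) * exp (- \<alpha> m * complex_of_real t))"
    unfolding h exp_poly_kernel_def ..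
  have disj: "{1..M0} \<inter> T = {}" "{1..M0} \<inter> \<sigma> ` T = {}" "T \<inter> \<sigma> ` T = {}"
    unfolding image by (auto simp: T_def)
  have fin: "finite T" by (simp add: T_def)
  have inv: "\<sigma> (\<sigma> m) = m" if "m \<in> T" for m using \<sigma>_T[OF that] by simp
  note * = hankel_inertia[OF finite_atLeastAtMost fin disj A \<sigma> inv distinct Re_pos degree cnj h']
  show ?thesis
    using * unfolding H by (simp add: T_def)
qed

end
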